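(* For every integer $n\ge 1$, the map $$\iota_n(\lambda):=\mathcal T\left(\left(\Phi_3^{-1}(\Gamma(\lambda))\right)'\right)$$ is a bijection $\iota_n:\mathcal C_3(n)\longrightarrow\mathcal D_3^{(0)}(n)$. In particular, if $n$ is not one more than a triangular number (i.e. $n\neq r(r+1)/2+1$ for every integer $r\ge0$), then $$|\mathcal C_3(n)|=|\mathcal D_3^{(0)}(n)|=|\mathcal D_3^{(1)}(n)|=|\mathcal D_3^{(2)}(n)|=\frac{D_3(n)}{3}.$$
   Context: A partition is a weakly decreasing finite list of nonnegative integers; its weight is the sum of its parts. Zero parts are allowed only in $\mathcal D_3$; all other partitions have positive parts. $\ell(\sigma)$ is the number of parts, and $\sigma'$ is the conjugate partition, $\sigma'_i=\#\{j:\sigma_j\ge i\}$. **The families.** For $n\ge1$, $\mathcal C_3(n)$ is the set of partitions $\lambda$ of $n$ into positive parts such that the largest part is divisible by $3$, say equal to $3J$, and every part of $\lambda$ that is at most $J$ occurs at most twice. $\mathcal D_3(n)$ is the set of partitions $\mu$ of $n$ into nonnegative parts (zeros count as parts) such that the smallest part occurs exactly three times and every strictly larger part occurs at most twice. $D_3(n):=|\mathcal D_3(n)|$. For $\mu\in\mathcal D_3(n)$, $\tau(\mu)$ is the number of parts (with multiplicity) strictly larger than the smallest part, and $\mathcal D_3^{(i)}(n):=\{\mu\in\mathcal D_3(n):\tau(\mu)\equiv i\pmod 3\}$. **The map $\Gamma$.** $\mathcal B_3^{(2)}(N)$ is the set of partitions of $N$ into positive parts not divisible by $3$ whose largest part is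 congruent to $2$ modulo $3$ (so $\mathcal B_3^{(2)}(0)=\varnothing$). $\Gamma:\mathcal C_3(n)\to\mathcal B_3^{(2)}(n-1)$: given $\lambda\in\mathcal C_3(n)$ with largest part $3J$, replace one copy of the largest part by $3J-1$; replace every other part $t=3^a u$ ($3\nmid u$) by $3^a$ copies of $u$; sort. **The map $\Phi_3$ and its inverse.** A positive partition $\alpha=(\alpha_1,\dots,\alpha_r)$ is $3$-flat if $\alpha_i-\alpha_{i+1}<3$ for $1\le i<r$ and $\alpha_r<3$; it is $3$-regular if no part is divisible by $3$. (The empty partition is both.) The nonzero residue sequence $\operatorname{res}(\alpha)$ is obtained by deleting the parts divisible by $3$ and recording the residues modulo $3$ of the remaining parts, in order. For $v=(v_1,\dots,v_k)$ with $v_i\in\{1,2\}$, the residue core $\Lambda(v)$ is the unique $3$-flat, $3$-regular partition $(c_1,\dots,c_k)$ with $c_i\equiv v_i\pmod 3$: $c_k=v_k$, and $c_i$ is the unique element of $\{c_{i+1},c_{i+1}+1,c_{i+1}+2\}$ congruent to $v_i$ mod $3$. A part $A_i$ of a $3$-flat partition $A$ is flat-removable if $3\mid A_i$ and deleting that one part leaves a $3$-flat partition. $\Phi_3$ maps $3$-flat partitions of $N$ to $3$-regular partitions of $N$ as follows. (S1) Start with $A=\alpha$ and an empty record list. (S2) Scan $A$ from smallest part to largest; whenever the current part is flat-removable, delete it and append one third of its value to the record list; the scan is dynamic (after a deletion, continue with the next part above the deleted part). (S3) Scan the remaining partition from largest part to smallest; if the current part is $A_i=3a$, delete it, subtract $3$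 from each of the $i-1$ larger parts, and append $a+i-1$ to the record list. (S4) The remaining partition is $\Lambda(\operatorname{res}(\alpha))$; sort the record list into a partition $\nu$ and set $\Phi_3(\alpha):=\Lambda(\operatorname{res}(\alpha))+3\nu'$ (componentwise, missing parts treated as $0$). $\Phi_3$ is a bijection (the modulus $3$ case of a bijection of Stockhofe), and $\Phi_3^{-1}$ is computed explicitly as follows. Given a $3$-regular $\beta$, let $A=\Lambda(\operatorname{res}(\beta))$, $q_i=(\beta_i-A_i)/3$, $q=(q_1,q_2,\dots)$ (a partition), $\nu=q'$. Starting from the current partition $A$, read the parts $p$ of $\nu$ from largest to smallest and for each perform an admissible insertion of size $p$: the admissible hard insertion if one exists, otherwise the easy insertion. A hard insertion of size $p$ chooses an integer $h$ with $0\le h\le p-1$, $h$ not exceeding the current length, adds $3$ to the first $h$ parts, and inserts a new part $3(p-h)$ immediately after those $h$ parts; it is admissible if the result is $3$-flat and the inserted part is not flat-removable. An easy insertion of size $p$ inserts a new part $3p$ in weakly decreasing order; it is admissible if the result is $3$-flat and the inserted part is flat-removable. The final partition is $\Phi_3^{-1}(\beta)$. **The map $\mathcal T$.** $\mathcal R(N)$ is the set of positive partitions $\sigma$ of $N$ such that no part occurs three or more times, and either $\ell(\sigma)\equiv2\pmod3$, or $\sigma$ is nonempty with $\ell(\sigma)\equiv0\pmod3$ and the smallest part of $\sigma$ occurs exactly once. $\mathcal T:\mathcal R(N)\to\mathcal D_3^{(0)}(N+1)$: if $\ell(\sigma)\equiv2\pmod 3$, adjoin a new part $1$; if $\ell(\sigma)\equiv0\pmod3$,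 raise the unique smallest part by $1$. Call the result $\eta$. If the smallest part of $\eta$ occurs exactly three times, $\mathcal T(\sigma)=\eta$; otherwise $\mathcal T(\sigma)=\eta\cup(0,0,0)$. *)

theory Defs
  imports Complex_Main "HOL-Library.More_List" "HOL-Computational_Algebra.Primes"
begin

text \<open>
  A partition is a weakly decreasing list of natural numbers, its weight is
  \<open>sum_list\<close> and its number of parts is \<open>length\<close>. Because the list is weakly decreasing, \<open>hd\<close> is
  the largest part and \<open>last\<close> the smallest part. List positions are counted from 0.
\<close>

definition partition :: "nat list \<Rightarrow> bool" where
  "partition xs \<longleftrightarrow> sorted_wrt (\<ge>) xs"

definition pos_partition :: "nat list \<Rightarrow> bool" where
  "pos_partition xs \<longleftrightarrow> partition xs \<and> (\<forall>x\<in>set xs. 0 < x)"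

definition sort_desc :: "nat list \<Rightarrow> nat list" where
  "sort_desc xs = rev (sort xs)"

definition conjugate :: "nat list \<Rightarrow> nat list" where
  "conjugate xs =
    (if xs = [] then []
     else map (\<lambda>i. length (filter (\<lambda>x. i \<le> x) xs)) [1..<Suc (hd xs)])"

definition delete_at :: "nat \<Rightarrow> 'a list \<Rightarrow> 'a list" where
  "delete_at i xs = take i xs @ drop (Suc i) xs"

definition C3 :: "nat \<Rightarrow> nat list set" where
  "C3 n = {xs. pos_partition xs \<and> sum_list xs = n \<and> xs \<noteq> [] \<and>
     (\<exists>J. hd xs = 3 * J \<and> (\<forall>x\<in>set xs. x \<le> J \<longrightarrow> count_list xs x \<le> 2))}"

definition D3 :: "nat \<Rightarrow> nat list set" where
  "D3 n = {xs. partition xs \<and> sum_list xs = n \<and> xs \<noteq> [] \<and>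
     count_list xs (last xs) = 3 \<and>
     (\<forall>x\<in>set xs. last xs < x \<longrightarrow> count_list xs x \<le> 2)}"

definition tau :: "nat list \<Rightarrow> nat" where
  "tau xs = length (filter (\<lambda>x. last xs < x) xs)"

definition D3_class :: "nat \<Rightarrow> nat \<Rightarrow> nat list set" where
  "D3_class i n = {xs \<in> D3 n. tau xs mod 3 = i mod 3}"

definition split3 :: "nat \<Rightarrow> nat list" where
  "split3 t = replicate (3 ^ multiplicity 3 t) (t div 3 ^ multiplicity 3 t)"

definition Gamma3 :: "nat list \<Rightarrow> nat list" where
  "Gamma3 xs = sort_desc ((hd xs - 1) # concat (map split3 (tl xs)))"

definition flat3 :: "nat list \<Rightarrow> bool" where
  "flat3 xs \<longleftrightarrow> pos_partition xs \<and>
     (\<forall>i. Suc i < length xs \<longrightarrow> xs ! i - xs ! Suc i < 3) \<and>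
     (xs \<noteq> [] \<longrightarrow> last xs < 3)"

definition res3 :: "nat list \<Rightarrow> nat list" where
  "res3 xs = map (\<lambda>x. x mod 3) (filter (\<lambda>x. \<not> 3 dvd x) xs)"

fun residue_core :: "nat list \<Rightarrow> nat list" where
  "residue_core [] = []"
| "residue_core [v] = [v]"
| "residue_core (v # w # vs) =
    (let cs = residue_core (w # vs)
     in (THE c. c \<in> {hd cs, hd cs + 1, hd cs + 2} \<and> c mod 3 = v mod 3) # cs)"

definition flat_removable :: "nat list \<Rightarrow> nat \<Rightarrow> bool" where
  "flat_removable xs i \<longleftrightarrow> i < length xs \<and> 3 dvd xs ! i \<and> flat3 (delete_at i xs)"

text \<open>
  Step (S2). In \<open>scan_up i xs r\<close> the current partition is \<open>xs\<close>, the record list is \<open>r\<close>, and the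
  parts at positions \<open>i - 1, \<dots>, 0\<close> are still to be scanned, in this order. A deletion does
  not change the positions of the parts still to be scanned.
\<close>

fun scan_up :: "nat \<Rightarrow> nat list \<Rightarrow> nat list \<Rightarrow> nat list \<times> nat list" where
  "scan_up 0 xs r = (xs, r)"
| "scan_up (Suc i) xs r =
    (if flat_removable xs i then scan_up i (delete_at i xs) (r @ [xs ! i div 3])
     else scan_up i xs r)"

text \<open>
  Step (S3). In \<open>scan_down ps xs r\<close> the current partition is \<open>ps @ xs\<close>, where \<open>ps\<close> has been
  scanned and \<open>xs\<close> has not, and \<open>r\<close> is the record list. The current part is the head of \<open>xs\<close>, so
  the number \<open>i - 1\<close> of parts preceding it is \<open>length ps\<close>. The result is the final record list.
\<close>

fun scan_down :: "nat list \<Rightarrow> nat list \<Rightarrow> nat list \<Rightarrow> nat list" where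
  "scan_down ps [] r = r"
| "scan_down ps (x # xs) r =
    (if 3 dvd x then scan_down (map (\<lambda>y. y - 3) ps) xs (r @ [x div 3 + length ps])
     else scan_down (ps @ [x]) xs r)"

definition Phi3_record :: "nat list \<Rightarrow> nat list" where
  "Phi3_record xs = (case scan_up (length xs) xs [] of (ys, r) \<Rightarrow> scan_down [] ys r)"

definition add_3_times :: "nat list \<Rightarrow> nat list \<Rightarrow> nat list" where
  "add_3_times xs ys =
    map (\<lambda>i. nth_default 0 xs i + 3 * nth_default 0 ys i) [0..<max (length xs) (length ys)]"

definition Phi3 :: "nat list \<Rightarrow> nat list" where
  "Phi3 xs = add_3_times (residue_core (res3 xs)) (conjugate (sort_desc (Phi3_record xs)))"

text \<open>\<open>\<Phi>\<^sub>3\<close> preserves the weight, so its inverse is taken on the 3-flat partitions of the same weight.\<close>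

definition Phi3_inv :: "nat list \<Rightarrow> nat list" where
  "Phi3_inv ys = the_inv_into {xs. flat3 xs \<and> sum_list xs = sum_list ys} Phi3 ys"

text \<open>
  The map is only used on partitions of length 0 or 2 modulo 3 (in the first case nonempty, with a
  smallest part that occurs once). There, both branches produce a weakly decreasing list.
\<close>

definition T_raise :: "nat list \<Rightarrow> nat list" where
  "T_raise xs = (if length xs mod 3 = 2 then xs @ [1] else butlast xs @ [last xs + 1])"

definition T_map :: "nat list \<Rightarrow> nat list" where
  "T_map xs =
    (let ys = T_raise xs in if count_list ys (last ys) = 3 then ys else ys @ [0, 0, 0])"

definition iota :: "nat list \<Rightarrow> nat list" where
  "iota xs = T_map (conjugate (Phi3_inv (Gamma3 xs)))"

end

theory Submission
  imports Defs "HOL-Library.Multiset" "HOL-Computational_Algebra.Formal_Power_Series"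
begin

text \<open>
  \<open>iota\<close> is a composition of four bijections. For \<open>Gamma3\<close> this is Glaisher's argument: for each
  \<open>u\<close> prime to 3, the multiplicities of the parts \<open>3\<^sup>a u\<close> are the digits of a ternary expansion whose top
  digit is unbounded. For \<open>\<Phi>\<^sub>3\<close>, a 3-flat partition is determined by its nonzero residues
  and by the numbers of multiples of 3 in the gaps between them. Reading the gaps from the smallest
  part upwards, with \<open>i\<close> nonmultiples above the current gap and smallest possible record value \<open>a\<close>,
  the remaining gaps correspond bijectively to the multisets on \<open>{a, \<dots>, a + i}\<close>: the
  gap contributes copies of \<open>a\<close>, where in a gap whose filling raises all larger parts by 3 one copy is replaced by \<open>a + i\<close>,
  a value that no later gap can then produce if the gap is empty. Conjugation turns flatness into the bound 2 on multiplicities, and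
  \<open>\<Phi>\<^sub>3\<close> preserves the first nonzero residue, which is 2 on one side iff the conjugate lies in the
  domain of \<open>T_map\<close>.

  For the equidistribution let \<open>\<omega>\<close> be a primitive cube root of unity. Up to the constant term, the generating
  function of \<open>\<omega>\<close> to the power \<open>tau\<close> telescopes to \<open>\<omega>\<close> times the sum of
  \<open>q\<^sup>m (1 + \<omega> q\<^sup>m + \<omega>\<^sup>2 q\<^sup>2\<^sup>m) (1 + \<omega> q\<^sup>m\<^sup>+\<^sup>1 + \<omega>\<^sup>2 q\<^sup>2\<^sup>m\<^sup>+\<^sup>2) \<dots>\<close> over \<open>m \<ge> 1\<close>, which is a partial theta series in
  \<open>- \<omega>\<^sup>2\<close> supported on exponents one above a triangular number.
\<close>

section \<open>Partitions and conjugation\<close>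

lemma partition_Nil [simp]: "partition []"
  by (simp add: partition_def)

lemma partition_Cons [simp]: "partition (x # xs) \<longleftrightarrow> (\<forall>y\<in>set xs. y \<le> x) \<and> partition xs"
  by (simp add: partition_def)

lemma partition_append:
  "partition (xs @ ys) \<longleftrightarrow> partition xs \<and> partition ys \<and> (\<forall>x\<in>set xs. \<forall>y\<in>set ys. y \<le> x)"
  by (auto simp: partition_def sorted_wrt_append)

lemma partition_iff_sorted_rev: "partition xs \<longleftrightarrow> sorted (rev xs)"
  by (simp add: partition_def sorted_wrt_rev)

lemma partition_mset_eqI:
  assumes "partition xs" "partition ys" "mset xs = mset ys"
  shows "xs = ys"
proof -
  have "rev xs = rev ys"
    using assms by (metis mset_rev partition_iff_sorted_rev sorted_sort_id properties_for_sort)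
  then show ?thesis by simp
qed

lemma partition_sort_desc [simp]: "partition (sort_desc xs)"
  by (simp add: sort_desc_def partition_iff_sorted_rev)

lemma mset_sort_desc [simp]: "mset (sort_desc xs) = mset xs"
  by (simp add: sort_desc_def)

lemma set_sort_desc [simp]: "set (sort_desc xs) = set xs"
  by (simp add: sort_desc_def)

lemma sum_list_sort_desc [simp]: "sum_list (sort_desc xs) = sum_list xs"
  by (metis mset_sort_desc sum_mset_sum_list)

lemma partition_le_hd: "partition xs \<Longrightarrow> x \<in> set xs \<Longrightarrow> x \<le> hd xs"
  by (cases xs) auto

lemma partition_last_le: "partition xs \<Longrightarrow> x \<in> set xs \<Longrightarrow> last xs \<le> x"
  by (induction xs) auto

lemma partition_nth_default_antimono:
  "partition xs \<Longrightarrow> i \<le> j \<Longrightarrow> nth_default 0 xs j \<le> nth_default 0 xs i"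
  by (auto simp: nth_default_def partition_def sorted_wrt_iff_nth_less nat_less_le)

lemma pos_partition_nth_default_pos:
  "pos_partition xs \<Longrightarrow> 0 < nth_default 0 xs i \<longleftrightarrow> i < length xs"
  by (auto simp: nth_default_def pos_partition_def)

text \<open>Padding with zeros loses nothing here: with positive parts the length is the number of
  nonzero entries.\<close>

lemma pos_partition_eqI:
  assumes "pos_partition xs" "pos_partition ys"
    and "\<And>i. nth_default 0 xs i = nth_default 0 ys i"
  shows "xs = ys"
proof -
  have "i < length xs \<longleftrightarrow> i < length ys" for i
    using assms pos_partition_nth_default_pos by metis
  then have len: "length xs = length ys"
    by (metis less_irrefl_nat linorder_neqE_nat)
  show ?thesis
  proof (rule nth_equalityI[OF len])
    fix i assume "i < length xs"
    with len assms(3)[of i] show "xs ! i = ys ! i" by (simp add: nth_default_nth)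
  qed
qed

text \<open>Both sides say that the Young diagram has a cell in row \<open>j\<close> and column
  \<open>i\<close>; the symmetry of this relation makes conjugation an involution.\<close>

lemma less_length_filter_iff:
  "partition xs \<Longrightarrow> j < length (filter (\<lambda>x. i < x) xs) \<longleftrightarrow> i < nth_default 0 xs j"
proof (induction xs arbitrary: j)
  case (Cons x xs)
  show ?case
  proof (cases "i < x")
    case True
    with Cons show ?thesis by (cases j) auto
  next
    case False
    then have "filter (\<lambda>x. i < x) (x # xs) = []"
      using Cons.prems by (auto simp: filter_empty_conv)
    moreover have "nth_default 0 (x # xs) j \<le> x"
      using partition_nth_default_antimono[OF Cons.prems, of 0 j] by simp
    ultimately show ?thesis using False by simp
  qed
qed simp

lemma length_conjugate: "length (conjugate xs) = (if xs = [] then 0 else hd xs)"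
  by (simp add: conjugate_def)

lemma nth_default_conjugate:
  assumes "partition xs"
  shows "nth_default 0 (conjugate xs) i = length (filter (\<lambda>x. i < x) xs)"
proof (cases "i < length (conjugate xs)")
  case True
  then have "xs \<noteq> []" "i < hd xs" by (auto simp: length_conjugate split: if_splits)
  moreover have "(\<le>) (Suc i) = (<) i" by (auto simp: fun_eq_iff)
  ultimately show ?thesis using True
    by (simp add: nth_default_def conjugate_def del: upt_Suc)
next
  case False
  then have "filter (\<lambda>x. i < x) xs = []"
    using partition_le_hd[OF assms] by (fastforce simp: length_conjugate filter_empty_conv split: if_splits)
  with False show ?thesis by (simp add: nth_default_def)
qed

lemma pos_partition_conjugate:
  assumes "partition xs"
  shows "pos_partition (conjugate xs)"
proof -
  have len: "length (filter (\<lambda>x. j \<le> x) xs) \<le> length (filter (\<lambda>x. i \<le> x) xs)" if "i < j" for i j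
    using that by (induction xs) auto
  have pos: "0 < length (filter (\<lambda>x. i \<le> x) xs)" if "xs \<noteq> []" "i \<le> hd xs" for i
    using that by (cases xs) auto
  show ?thesis
    using len pos
    by (auto simp: pos_partition_def partition_def conjugate_def sorted_wrt_map less_Suc_eq_le
      intro!: sorted_wrt_mono_rel[OF _ sorted_wrt_upt] simp del: upt_Suc)
qed

lemma length_filter_conjugate:
  assumes "partition xs"
  shows "length (filter (\<lambda>y. i < y) (conjugate xs)) = nth_default 0 xs i"
proof -
  have "j < length (filter (\<lambda>y. i < y) (conjugate xs)) \<longleftrightarrow> j < nth_default 0 xs i" for j
    using assms pos_partition_conjugate[of xs]
    by (simp add: nth_default_conjugate less_length_filter_iff pos_partition_def)
  then show ?thesis
    by (metis less_irrefl_nat linorder_neqE_nat)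
qed

lemma conjugate_conjugate:
  assumes "pos_partition xs"
  shows "conjugate (conjugate xs) = xs"
proof (rule pos_partition_eqI)
  have p: "partition xs" "partition (conjugate xs)"
    using assms pos_partition_conjugate by (auto simp: pos_partition_def)
  then show "pos_partition (conjugate (conjugate xs))" by (simp add: pos_partition_conjugate)
  show "nth_default 0 (conjugate (conjugate xs)) j = nth_default 0 xs j" for j
    using p by (simp add: nth_default_conjugate length_filter_conjugate)
qed (fact assms)

lemma sum_length_filter_less:
  fixes xs :: "nat list"
  shows "\<forall>x\<in>set xs. x \<le> h \<Longrightarrow> (\<Sum>i<h. length (filter (\<lambda>x. i < x) xs)) = sum_list xs"
proof (induction xs)
  case (Cons x xs)
  have "(\<Sum>i<h. length (filter (\<lambda>y. i < y) (x # xs)))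
      = (\<Sum>i<h. of_bool (i < x) + length (filter (\<lambda>x. i < x) xs))"
    by (intro sum.cong) auto
  also have "\<dots> = card ({..<h} \<inter> {i. i < x}) + sum_list xs"
    using Cons by (simp add: sum.distrib flip: lessThan_def)
  also have "{..<h} \<inter> {i. i < x} = {..<x}" using Cons.prems by auto
  finally show ?case by simp
qed simp

lemma sum_list_conjugate:
  assumes "partition xs"
  shows "sum_list (conjugate xs) = sum_list xs"
proof (cases "xs = []")
  case False
  have "sum_list (conjugate xs) = (\<Sum>i<hd xs. nth_default 0 (conjugate xs) i)"
    using False by (simp add: sum_list_sum_nth length_conjugate atLeast0LessThan nth_default_nth)
  also have "\<dots> = sum_list xs"
    using assms partition_le_hd by (simp add: nth_default_conjugate sum_length_filter_less)
  finally show ?thesis .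
qed (simp add: conjugate_def)

section \<open>Multiplicities in the conjugate and 3-flatness\<close>

lemma count_list_replicate: "count_list (replicate k y) x = (if x = y then k else 0)"
  by (induction k) auto

lemma count_list_Suc:
  "count_list xs (Suc i) = length (filter (\<lambda>x. i < x) xs) - length (filter (\<lambda>x. Suc i < x) xs)"
proof -
  have "length (filter (\<lambda>x. i < x) xs) = count_list xs (Suc i) + length (filter (\<lambda>x. Suc i < x) xs)"
    by (induction xs) auto
  then show ?thesis by simp
qed

lemma count_list_conjugate:
  assumes "pos_partition xs"
  shows "count_list (conjugate xs) (Suc i) = nth_default 0 xs i - nth_default 0 xs (Suc i)"
  using assms by (simp add: count_list_Suc length_filter_conjugate pos_partition_def)

text \<open>The default value 0 past the end turns the condition on the smallest part into one more
  difference condition.\<close>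

lemma flat3_iff:
  "flat3 xs \<longleftrightarrow> pos_partition xs \<and> (\<forall>i. nth_default 0 xs i - nth_default 0 xs (Suc i) < 3)"
proof -
  have "(\<forall>i. Suc i < length xs \<longrightarrow> xs ! i - xs ! Suc i < 3) \<and> (xs \<noteq> [] \<longrightarrow> last xs < 3) \<longleftrightarrow>
      (\<forall>i. nth_default 0 xs i - nth_default 0 xs (Suc i) < 3)" (is "?l \<longleftrightarrow> ?r")
  proof
    assume l: ?l
    show ?r
    proof
      fix i
      consider "Suc i < length xs" | "Suc i = length xs" | "Suc i > length xs" by linarith
      then show "nth_default 0 xs i - nth_default 0 xs (Suc i) < 3"
      proof cases
        case 2
        then have "xs \<noteq> []" "i = length xs - 1" by auto
        with l show ?thesis by (simp add: nth_default_def last_conv_nth)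
      qed (use l in \<open>auto simp: nth_default_def\<close>)
    qed
  next
    assume r: ?r
    have "last xs < 3" if "xs \<noteq> []"
      using r[rule_format, of "length xs - 1"] that by (simp add: nth_default_def last_conv_nth)
    moreover have "xs ! i - xs ! Suc i < 3" if "Suc i < length xs" for i
      using r[rule_format, of i] that by (simp add: nth_default_def)
    ultimately show ?l by blast
  qed
  then show ?thesis by (auto simp: flat3_def)
qed

lemma flat3_iff_count_list_conjugate:
  assumes "pos_partition xs"
  shows "flat3 xs \<longleftrightarrow> (\<forall>x. count_list (conjugate xs) x \<le> 2)"
proof -
  have "count_list (conjugate xs) 0 = 0"
    using assms pos_partition_conjugate[of xs] by (auto simp: pos_partition_def count_list_0_iff)
  then have "(\<forall>x. count_list (conjugate xs) x \<le> 2) \<longleftrightarrow> (\<forall>i. count_list (conjugate xs) (Suc i) \<le> 2)"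
    by (metis not0_implies_Suc zero_le)
  also have "\<dots> \<longleftrightarrow> flat3 xs"
    using assms by (auto simp: flat3_iff count_list_conjugate less_Suc_eq_le numeral_3_eq_3 numeral_2_eq_2)
  finally show ?thesis by simp
qed

definition flat3_res2 :: "nat \<Rightarrow> nat list set" where
  "flat3_res2 N = {xs. flat3 xs \<and> sum_list xs = N \<and> res3 xs \<noteq> [] \<and> hd (res3 xs) = 2}"

definition R3 :: "nat \<Rightarrow> nat list set" where
  "R3 N = {xs. pos_partition xs \<and> sum_list xs = N \<and> (\<forall>x. count_list xs x \<le> 2) \<and>
     (length xs mod 3 = 2 \<or> xs \<noteq> [] \<and> length xs mod 3 = 0 \<and> count_list xs (last xs) = 1)}"

text \<open>The largest part \<open>h\<close> occurs \<open>m\<close> times, so \<open>m\<close> is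
  the smallest part of the conjugate, with multiplicity \<open>h\<close> minus the next smaller
  value. If 3 divides \<open>h\<close>, flatness makes that value \<open>h - 1\<close> or
  \<open>h - 2\<close>, with residue 2 or 1; residue 2 thus means multiplicity 1.\<close>

lemma hd_res3_eq_2_iff:
  assumes "flat3 xs" "xs \<noteq> []"
  shows "res3 xs \<noteq> [] \<and> hd (res3 xs) = 2 \<longleftrightarrow>
    hd xs mod 3 = 2 \<or> hd xs mod 3 = 0 \<and> count_list (conjugate xs) (last (conjugate xs)) = 1"
proof -
  define h where "h = hd xs"
  define m where "m = length (takeWhile (\<lambda>x. x = h) xs)"
  define ys where "ys = dropWhile (\<lambda>x. x = h) xs"
  have "takeWhile (\<lambda>x. x = h) xs = replicate m h"
    unfolding m_def by (intro replicate_eqI) (auto dest: set_takeWhileD)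
  then have xs: "xs = replicate m h @ ys"
    unfolding ys_def by (metis takeWhile_dropWhile_id)
  have m: "m > 0" unfolding m_def h_def using assms(2) by (cases xs) auto
  have pos: "pos_partition xs" and part: "partition xs"
    using assms(1) by (auto simp: flat3_def pos_partition_def)
  have hpos: "h > 0" using pos m by (auto simp: pos_partition_def xs)
  have ysne: "hd ys \<noteq> h" if "ys \<noteq> []" using that unfolding ys_def by (rule hd_dropWhile)
  have hdys: "nth_default 0 xs m < h" "h - nth_default 0 xs m < 3"
  proof -
    have "nth_default 0 xs m = nth_default 0 ys 0" unfolding xs by (simp add: nth_default_append)
    moreover have "nth_default 0 ys 0 < h"
      using ysne part hpos xs m by (cases ys) (auto simp: partition_append)
    ultimately show "nth_default 0 xs m < h" by simp
    have "nth_default 0 xs (m - 1) = h" unfolding xs using m by (simp add: nth_default_append)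
    then show "h - nth_default 0 xs m < 3"
      using assms(1) m unfolding flat3_iff by (metis Suc_diff_1)
  qed
  have "filter (\<lambda>x. h - 1 < x) ys = []"
    using part ysne hpos m unfolding xs
    by (cases ys) (auto simp: filter_empty_conv partition_append)
  then have "nth_default 0 (conjugate xs) (h - 1) = m"
    unfolding nth_default_conjugate[OF part] using hpos by (simp add: xs)
  then have last: "last (conjugate xs) = m"
    using hpos assms(2) h_def length_conjugate[of xs]
    by (subst last_conv_nth) (auto simp: nth_default_def)
  have cnt: "count_list (conjugate xs) m = h - nth_default 0 xs m"
    using count_list_conjugate[OF pos, of "m - 1"] m
    by (simp add: xs nth_default_append)
  show ?thesis
  proof (cases "h mod 3 = 0")
    case False
    have "xs = h # tl xs" using assms(2) h_def by simp
    then have "res3 xs = (h mod 3) # res3 (tl xs)"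
      using False by (metis (no_types, lifting) filter.simps(2) list.simps(9) mod_0_imp_dvd mod_eq_0_iff_dvd res3_def)
    then show ?thesis using False h_def by simp
  next
    case True
    \<comment> \<open>Were all parts equal to \<open>h\<close>, flatness would give
      \<open>h < 3\<close>, but \<open>h\<close> is a positive multiple of 3.\<close>
    have ne: "ys \<noteq> []"
    proof
      assume "ys = []"
      then have "nth_default 0 xs m = 0" by (simp add: xs nth_default_def)
      with hdys True hpos show False by (simp add: mod_less)
    qed
    then have nd: "nth_default 0 xs m = hd ys"
      by (cases ys) (auto simp: xs nth_default_append)
    have res: "res3 xs = res3 ys" using True by (simp add: xs res3_def mod_eq_0_iff_dvd)
    have "hd ys = h - 1 \<or> hd ys = h - 2" using hdys nd by linarith
    moreover obtain k where k: "h = 3 * k + 3"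
    proof -
      have "h = 3 * (h div 3)" "h div 3 \<noteq> 0" using True hpos by auto
      then show ?thesis using that[of "h div 3 - 1"] by simp
    qed
    moreover have "(3 * k + 2) mod 3 = 2" "(3 * k + 1) mod 3 = 1" by presburger+
    ultimately have "hd ys mod 3 = (if hd ys = h - 1 then 2 else 1)" by auto
    moreover from this have "res3 ys = (hd ys mod 3) # res3 (tl ys)"
      using ne by (cases ys) (auto simp: res3_def split: if_splits)
    ultimately show ?thesis
      using True hdys nd k unfolding res last cnt h_def[symmetric] by (auto split: if_splits)
  qed
qed

text \<open>The largest part of \<open>xs\<close> is the length of its conjugate, so
  \<open>hd_res3_eq_2_iff\<close> becomes the length condition of \<open>R3\<close>. Since
  conjugation is an involution, one equivalence serves both directions.\<close>

lemma bij_betw_conjugate: "bij_betw conjugate (flat3_res2 N) (R3 N)"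
proof (rule bij_betw_byWitness[where f' = conjugate])
  have iff: "xs \<in> flat3_res2 N \<longleftrightarrow> conjugate xs \<in> R3 N" if "pos_partition xs" for xs
  proof (cases "xs = []")
    case False
    then have "conjugate xs \<noteq> []"
      using that by (metis conjugate_conjugate conjugate_def)
    then show ?thesis
      using that False pos_partition_conjugate[of xs] hd_res3_eq_2_iff[of xs] flat3_iff_count_list_conjugate[of xs]
      by (auto simp: flat3_res2_def R3_def sum_list_conjugate pos_partition_def length_conjugate)
  qed (simp add: flat3_res2_def R3_def conjugate_def res3_def)
  have pos: "pos_partition xs" if "xs \<in> flat3_res2 N \<or> xs \<in> R3 N" for xs
    using that by (auto simp: flat3_res2_def R3_def flat3_def)
  show "\<forall>xs\<in>flat3_res2 N. conjugate (conjugate xs) = xs" "\<forall>xs\<in>R3 N. conjugate (conjugate xs) = xs"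
    using pos conjugate_conjugate by auto
  show "conjugate ` flat3_res2 N \<subseteq> R3 N" using iff pos by blast
  show "conjugate ` R3 N \<subseteq> flat3_res2 N"
  proof
    fix ys assume "ys \<in> conjugate ` R3 N"
    then obtain xs where xs: "xs \<in> R3 N" "ys = conjugate xs" by blast
    then have "pos_partition xs" using pos by blast
    then have "pos_partition ys" "conjugate ys = xs"
      unfolding xs(2) using pos_partition_conjugate conjugate_conjugate pos_partition_def by blast+
    with iff xs show "ys \<in> flat3_res2 N" by auto
  qed
qed

section \<open>Codes of 3-flat partitions\<close>

text \<open>Relates a part to the next larger one. Partitions are listed downwards but codes are
  read upwards, so flatness is used as \<open>successively close3\<close> on reversed lists.\<close>

definition close3 :: "nat \<Rightarrow> nat \<Rightarrow> bool" where
  "close3 x y \<longleftrightarrow> x \<le> y \<and> y < x + 3"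

lemma flat3_Nil [simp]: "flat3 []"
  by (simp add: flat3_def pos_partition_def)

lemma flat3_singleton [simp]: "flat3 [x] \<longleftrightarrow> 0 < x \<and> x < 3"
  by (auto simp: flat3_def pos_partition_def)

lemma flat3_Cons_Cons [simp]: "flat3 (x # y # xs) \<longleftrightarrow> close3 y x \<and> flat3 (y # xs)"
proof -
  have all_nat: "(\<forall>i. Q i) \<longleftrightarrow> Q 0 \<and> (\<forall>i. Q (Suc i))" for Q :: "nat \<Rightarrow> bool"
    by (metis not0_implies_Suc)
  have "(\<forall>i. Suc i < length (x # y # xs) \<longrightarrow> (x # y # xs) ! i - (x # y # xs) ! Suc i < 3) \<longleftrightarrow>
      x - y < 3 \<and> (\<forall>i. Suc i < length (y # xs) \<longrightarrow> (y # xs) ! i - (y # xs) ! Suc i < 3)"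
    by (subst all_nat) auto
  moreover have "pos_partition (x # y # xs) \<longleftrightarrow> y \<le> x \<and> pos_partition (y # xs)"
    by (auto simp: pos_partition_def)
  ultimately show ?thesis
    by (auto simp: flat3_def close3_def)
qed

lemma flat3_Cons: "xs \<noteq> [] \<Longrightarrow> flat3 (x # xs) \<longleftrightarrow> close3 (hd xs) x \<and> flat3 xs"
  by (cases xs) auto

lemma flat3_rev_append_iff:
  "flat3 (rev zs @ y # ys) \<longleftrightarrow> flat3 (y # ys) \<and> successively close3 (y # zs)"
proof (induction zs rule: rev_induct)
  case (snoc z zs)
  have "hd (rev zs @ y # ys) = last (y # zs)"
    by (cases zs rule: rev_cases) auto
  with snoc show ?case
    using successively_append_iff[of close3 "y # zs" "[z]"] by (auto simp: flat3_Cons)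
qed simp

text \<open>A virtual part 0 at the bottom expresses that the smallest part is below 3. Positivity
  has to be added because \<open>close3 0 0\<close> holds.\<close>

lemma flat3_rev_iff: "flat3 (rev zs) \<longleftrightarrow> successively close3 (0 # zs) \<and> (zs \<noteq> [] \<longrightarrow> 0 < hd zs)"
  by (cases zs) (auto simp: flat3_rev_append_iff close3_def)

lemma successively_replicate_append:
  assumes "P z z"
  shows "successively P (p # replicate m z @ ys) \<longleftrightarrow>
    (m = 0 \<or> P p z) \<and> successively P ((if m = 0 then p else z) # ys)"
  using assms by (induction m arbitrary: p) auto

text \<open>
  A 3-flat partition is coded by a list of pairs \<open>(v, m)\<close>, smallest parts first: \<open>v\<close> is the residue of
  a part not divisible by 3 and \<open>m\<close> is the number of multiples of 3 between it and the next larger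
  such part. A gap is wide if the two neighbouring parts lie on different sides of a multiple of 3
  even when \<open>m = 0\<close>; exactly then (or above all nonmultiples) all its multiples of 3 are
  flat-removable.
\<close>

definition wide :: "nat \<Rightarrow> (nat \<times> nat) list \<Rightarrow> bool" where
  "wide v ps \<longleftrightarrow> ps = [] \<or> fst (hd ps) < v"

lemma wide_iff_map_fst: "wide v ps \<longleftrightarrow> map fst ps = [] \<or> hd (map fst ps) < v"
  by (cases ps) (auto simp: wide_def)

text \<open>The level \<open>a\<close> places the next nonmultiple between \<open>3 * a\<close> and
  \<open>3 * a + 3\<close>. A gap holds only copies of \<open>3 * a + 3\<close>, because flatness
  forbids a step from one multiple of 3 to the next. The level rises when the gap is filled or
  wide.\<close>

fun flat_parts :: "nat \<Rightarrow> (nat \<times> nat) list \<Rightarrow> nat list" where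
  "flat_parts a [] = []"
| "flat_parts a ((v, m) # ps) =
    (3 * a + v) # replicate m (3 * a + 3) @
      flat_parts (if m = 0 \<and> \<not> wide v ps then a else Suc a) ps"

text \<open>
  In a gap that is not wide, the last multiple of 3 stays until the downward scan, which adds to its
  record the number \<open>length ps\<close> of larger nonmultiples.
\<close>

fun flat_record :: "nat \<Rightarrow> (nat \<times> nat) list \<Rightarrow> nat multiset" where
  "flat_record a [] = {#}"
| "flat_record a ((v, m) # ps) =
    (if wide v ps then replicate_mset m (Suc a) + flat_record (Suc a) ps
     else if m = 0 then flat_record a ps
     else add_mset (Suc a + length ps) (replicate_mset (m - 1) (Suc a)) + flat_record (Suc a) ps)"

abbreviation letters :: "nat list \<Rightarrow> bool" where
  "letters vs \<equiv> set vs \<subseteq> {1, 2}"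

lemma flat_parts_eq_Nil [simp]: "flat_parts a ps = [] \<longleftrightarrow> ps = []"
  by (cases ps) auto

lemma hd_flat_parts: "ps \<noteq> [] \<Longrightarrow> hd (flat_parts a ps) = 3 * a + fst (hd ps)"
  by (cases ps) auto

lemma length_flat_parts: "length (flat_parts a ps) = length ps + sum_list (map snd ps)"
  by (induction a ps rule: flat_parts.induct) auto

lemma successively_flat_parts:
  assumes "letters (map fst ps)" "ps \<noteq> [] \<Longrightarrow> close3 p (3 * a + fst (hd ps))"
  shows "successively close3 (p # flat_parts a ps)"
  using assms
proof (induction a ps arbitrary: p rule: flat_parts.induct)
  case (2 a v m ps)
  have "successively close3 ((if m = 0 then 3 * a + v else 3 * a + 3) #
      flat_parts (if m = 0 \<and> \<not> wide v ps then a else Suc a) ps)"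
    using 2(2) by (intro 2(1)) (cases ps; force simp: close3_def wide_def)+
  then show ?case
    using 2 by (auto simp: successively_replicate_append close3_def)
qed simp

lemma flat3_rev_flat_parts:
  assumes "letters (map fst ps)"
  shows "flat3 (rev (flat_parts 0 ps))"
proof -
  have "fst (hd ps) = 1 \<or> fst (hd ps) = 2" if "ps \<noteq> []" using assms that by (cases ps) auto
  then have "close3 0 (3 * 0 + fst (hd ps))" "0 < fst (hd ps)" if "ps \<noteq> []"
    using that by (auto simp: close3_def)
  then show ?thesis
    using successively_flat_parts[OF assms, of 0 0] by (auto simp: flat3_rev_iff hd_flat_parts)
qed

text \<open>Peel off the smallest part and the multiples of 3 directly above it; what remains starts
  with a nonmultiple again and is decoded recursively.\<close>

lemma flat_parts_surj:
  assumes "successively close3 zs" "zs \<noteq> [] \<Longrightarrow> \<not> 3 dvd hd zs"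
  shows "\<exists>ps. letters (map fst ps) \<and> zs = flat_parts (hd zs div 3) ps"
  using assms
proof (induction "length zs" arbitrary: zs rule: less_induct)
  case less
  show ?case
  proof (cases zs)
    case Nil
    then show ?thesis by (intro exI[of _ "[]"]) auto
  next
    case (Cons z zs')
    define a where "a = z div 3"
    define v where "v = z mod 3"
    have z: "z = 3 * a + v" by (simp add: a_def v_def)
    have "v \<noteq> 0" using less.prems(2) Cons by (auto simp: v_def dvd_eq_mod_eq_0)
    moreover have "v < 3" by (simp add: v_def)
    ultimately have v: "v = 1 \<or> v = 2" by linarith
    define m where "m = length (takeWhile (\<lambda>x. x = 3 * a + 3) zs')"
    define ys where "ys = dropWhile (\<lambda>x. x = 3 * a + 3) zs'"
    have "takeWhile (\<lambda>x. x = 3 * a + 3) zs' = replicate m (3 * a + 3)"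
      unfolding m_def by (intro replicate_eqI) (auto dest: set_takeWhileD)
    then have zs': "zs' = replicate m (3 * a + 3) @ ys"
      unfolding ys_def by (metis takeWhile_dropWhile_id)
    have ysne: "hd ys \<noteq> 3 * a + 3" if "ys \<noteq> []" using that unfolding ys_def by (rule hd_dropWhile)
    have succ: "successively close3 ((if m = 0 then z else 3 * a + 3) # ys)"
      using less.prems(1) unfolding Cons zs'
      by (subst (asm) successively_replicate_append) (auto simp: close3_def)
    \<comment> \<open>The next nonmultiple stays at level \<open>a\<close> exactly if the gap is
      empty and the residue does not drop.\<close>
    have hdys: "hd ys div 3 = a \<and> v \<le> hd ys mod 3 \<and> m = 0 \<or> hd ys div 3 = Suc a \<and> (m \<noteq> 0 \<or> hd ys mod 3 < v)"
      "hd ys mod 3 \<noteq> 0" if ne: "ys \<noteq> []"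
    proof -
      have "close3 (if m = 0 then 3 * a + v else 3 * a + 3) (hd ys)"
        using succ ne by (cases ys) (auto simp: z)
      then consider "m = 0" "v = 1" "hd ys = 3 * a + 1" | "m = 0" "hd ys = 3 * a + 2"
        | "m = 0" "v = 2" "hd ys = 3 * Suc a + 1"
        | "m \<noteq> 0" "hd ys = 3 * Suc a + 1" | "m \<noteq> 0" "hd ys = 3 * Suc a + 2"
        using ysne[OF ne] v by (cases "m = 0") (auto simp: close3_def, linarith+)
      moreover have "(3 * b + 1) div 3 = b" "(3 * b + 2) div 3 = b" "(3 * b + 1) mod 3 = 1" "(3 * b + 2) mod 3 = 2" for b :: nat
        by presburger+
      ultimately show "hd ys div 3 = a \<and> v \<le> hd ys mod 3 \<and> m = 0 \<or> hd ys div 3 = Suc a \<and> (m \<noteq> 0 \<or> hd ys mod 3 < v)"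
        "hd ys mod 3 \<noteq> 0"
        using v by (cases; fastforce)+
    qed
    have "\<exists>ps. letters (map fst ps) \<and> ys = flat_parts (hd ys div 3) ps"
    proof (rule less.hyps)
      show "length ys < length zs" by (simp add: Cons zs')
      show "successively close3 ys" using succ by (cases ys) auto
      show "\<not> 3 dvd hd ys" if "ys \<noteq> []" using hdys(2)[OF that] by presburger
    qed
    then obtain ps where ps: "letters (map fst ps)" "ys = flat_parts (hd ys div 3) ps" by blast
    have "ys = flat_parts (if m = 0 \<and> \<not> wide v ps then a else Suc a) ps"
    proof (cases "ys = []")
      case True
      then have "ps = []" using ps(2) by (metis flat_parts_eq_Nil)
      with True show ?thesis by simp
    next
      case False
      then have "ps \<noteq> []" using ps(2) by auto
      then have "hd ys = 3 * (hd ys div 3) + fst (hd ps)" using ps(2) hd_flat_parts by metis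
      then have "fst (hd ps) = hd ys mod 3" by (metis add_left_cancel mult_div_mod_eq)
      then have "hd ys div 3 = (if m = 0 \<and> \<not> wide v ps then a else Suc a)"
        using hdys(1)[OF False] \<open>ps \<noteq> []\<close> by (auto simp: wide_def)
      then show ?thesis using ps by simp
    qed
    then have "zs = flat_parts (hd zs div 3) ((v, m) # ps)"
      by (simp add: Cons zs' z[symmetric] a_def[symmetric])
    moreover have "letters (map fst ((v, m) # ps))" using ps v by auto
    ultimately show ?thesis by blast
  qed
qed

lemma flat3_obtain:
  assumes "flat3 xs"
  obtains ps where "letters (map fst ps)" "xs = rev (flat_parts 0 ps)"
proof -
  have *: "successively close3 (0 # rev xs)" "rev xs \<noteq> [] \<Longrightarrow> 0 < hd (rev xs)"
    using assms flat3_rev_iff[of "rev xs"] by auto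
  then have "rev xs \<noteq> [] \<Longrightarrow> hd (rev xs) < 3"
    by (cases "rev xs") (auto simp: close3_def)
  with * have "rev xs \<noteq> [] \<Longrightarrow> \<not> 3 dvd hd (rev xs)" "rev xs \<noteq> [] \<Longrightarrow> hd (rev xs) div 3 = 0"
    by (auto dest: dvd_imp_le)
  moreover have "successively close3 (rev xs)" using * by (cases "rev xs") auto
  ultimately obtain ps where "letters (map fst ps)" "rev xs = flat_parts (hd (rev xs) div 3) ps"
    using flat_parts_surj by blast
  with that show ?thesis
    by (metis \<open>rev xs \<noteq> [] \<Longrightarrow> hd (rev xs) div 3 = 0\<close> flat_parts_eq_Nil rev_rev_ident flat_parts.simps(1))
qed

text \<open>An easy record in the first gap is \<open>Suc a\<close>, a hard one is \<open>a\<close>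
  plus the length of the whole code. Raising the level by one while dropping one entry keeps later
  records in this range.\<close>

lemma set_flat_record: "set_mset (flat_record a ps) \<subseteq> {a<..a + length ps}"
  by (induction a ps rule: flat_record.induct) (fastforce split: if_splits)+

lemma count_flat_record_le: "r \<le> a \<Longrightarrow> count (flat_record a ps) r = 0"
  using set_flat_record[of a ps] by (fastforce simp: not_in_iff[symmetric])

lemma count_flat_record_gt: "a + length ps < r \<Longrightarrow> count (flat_record a ps) r = 0"
  using set_flat_record[of a ps] by (fastforce simp: not_in_iff[symmetric])

text \<open>Records at level \<open>Suc a\<close> exceed \<open>Suc a\<close>, so the count of
  \<open>Suc a\<close> fixes the number of easy deletions in the first gap. If that gap is not wide,
  the top value \<open>?r\<close>, out of reach of later gaps at level \<open>a\<close>, first tells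
  whether it is empty.\<close>

lemma flat_record_inj:
  assumes "map fst ps = map fst qs" "flat_record a ps = flat_record a qs"
  shows "ps = qs"
  using assms
proof (induction a ps arbitrary: qs rule: flat_record.induct)
  case (2 a v m ps)
  obtain m' qs' where qs: "qs = (v, m') # qs'" "map fst ps = map fst qs'"
    using 2(4) by (cases qs) auto
  have w: "wide v ps \<longleftrightarrow> wide v qs'" and len: "length ps = length qs'"
    using qs(2) by (auto simp: wide_iff_map_fst dest: map_eq_imp_length_eq)
  show ?case
  proof (cases "wide v ps")
    case True
    have eq: "replicate_mset m (Suc a) + flat_record (Suc a) ps =
        replicate_mset m' (Suc a) + flat_record (Suc a) qs'"
      using 2(5) True w by (simp add: qs)
    from arg_cong[OF this, of "\<lambda>M. count M (Suc a)"] have "m = m'"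
      by (simp add: count_flat_record_le)
    with eq True 2(1) qs show ?thesis by simp
  next
    case False
    let ?r = "Suc a + length ps"
    have top: "?r \<in># flat_record a ((v, n) # rs) \<longleftrightarrow> n \<noteq> 0"
      if "length rs = length ps" "\<not> wide v rs" for n rs
    proof -
      have "?r \<notin># flat_record a rs"
        using that by (simp add: not_in_iff count_flat_record_gt)
      with that show ?thesis by auto
    qed
    have "m = 0 \<longleftrightarrow> m' = 0"
      using top[of ps m] top[of qs' m'] 2(5) False w len unfolding qs
      by (auto simp del: flat_record.simps)
    show ?thesis
    proof (cases "m = 0")
      case True
      then have "m' = 0" using \<open>m = 0 \<longleftrightarrow> m' = 0\<close> by simp
      with True 2(2)[OF False True, of qs'] 2(5) False w qs show ?thesis by simp
    next
      case m: False
      have eq: "replicate_mset (m - 1) (Suc a) + flat_record (Suc a) ps =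
          replicate_mset (m' - 1) (Suc a) + flat_record (Suc a) qs'"
        using 2(5) False m w len \<open>m = 0 \<longleftrightarrow> m' = 0\<close> by (simp add: qs)
      from arg_cong[OF this, of "\<lambda>M. count M (Suc a)"] have "m - 1 = m' - 1"
        by (simp add: count_flat_record_le)
      then show ?thesis
        using eq 2(3)[OF False m, of qs'] qs m \<open>m = 0 \<longleftrightarrow> m' = 0\<close> by simp
    qed
  qed
qed simp

text \<open>
  The part \<open>a + length vs\<close> can only come from a hard deletion in the first gap, so its presence in
  \<open>M\<close> decides whether that gap contains a multiple of 3.
\<close>

lemma flat_record_surj:
  assumes "set_mset M \<subseteq> {a<..a + length vs}"
  shows "\<exists>ps. map fst ps = vs \<and> flat_record a ps = M"
  using assms
proof (induction vs arbitrary: a M)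
  case (Cons v vs)
  have split: "M = replicate_mset (count M (Suc a)) (Suc a) + filter_mset (\<lambda>x. x \<noteq> Suc a) M" for M :: "nat multiset"
    by (simp add: multiset_eq_iff)
  show ?case
  proof (cases "vs = [] \<or> hd vs < v")
    case True
    have "set_mset (filter_mset (\<lambda>x. x \<noteq> Suc a) M) \<subseteq> {Suc a<..Suc a + length vs}"
      using Cons.prems by auto
    then obtain ps where ps: "map fst ps = vs" "flat_record (Suc a) ps = filter_mset (\<lambda>x. x \<noteq> Suc a) M"
      using Cons.IH by blast
    have "wide v ps" using True ps(1) by (auto simp: wide_iff_map_fst)
    then show ?thesis using ps split[of M]
      by (intro exI[of _ "(v, count M (Suc a)) # ps"]) simp
  next
    case False
    define r where "r = Suc a + length vs"
    show ?thesis
    proof (cases "r \<in># M")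
      case True
      define M' where "M' = M - {#r#}"
      have M: "M = add_mset r M'" using True by (simp add: M'_def)
      have "set_mset (filter_mset (\<lambda>x. x \<noteq> Suc a) M') \<subseteq> {Suc a<..Suc a + length vs}"
        using Cons.prems by (auto simp: M)
      then obtain ps where ps: "map fst ps = vs" "flat_record (Suc a) ps = filter_mset (\<lambda>x. x \<noteq> Suc a) M'"
        using Cons.IH by blast
      have "\<not> wide v ps" using False ps(1) by (auto simp: wide_iff_map_fst)
      moreover have "length ps = length vs" using ps by auto
      ultimately show ?thesis using ps split[of M']
        by (intro exI[of _ "(v, Suc (count M' (Suc a))) # ps"]) (simp add: M r_def)
    next
      case False': False
      have "set_mset M \<subseteq> {a<..a + length vs}"
      proof
        fix x assume "x \<in># M"
        with Cons.prems False' have "x \<in> {a<..r}" "x \<noteq> r" by (auto simp: r_def)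
        then show "x \<in> {a<..a + length vs}" by (auto simp: r_def)
      qed
      then obtain ps where ps: "map fst ps = vs" "flat_record a ps = M"
        using Cons.IH by blast
      have "\<not> wide v ps" using False ps(1) by (auto simp: wide_iff_map_fst)
      with ps show ?thesis by (intro exI[of _ "(v, 0) # ps"]) simp
    qed
  qed
qed simp

section \<open>Weight and residues of coded partitions\<close>

lemma wide_map_zero: "wide v (map (\<lambda>(v, m). (v, 0)) ps) \<longleftrightarrow> wide v ps"
  by (cases ps) (auto simp: wide_def)

text \<open>Raising the level lifts every part by 3. Applied to the code above a filled gap that is
  not wide, this gives the \<open>length ps\<close> in the hard record.\<close>

lemma sum_list_flat_parts_Suc:
  "sum_list (flat_parts (Suc a) (map (\<lambda>(v, m). (v, 0)) ps)) =
   sum_list (flat_parts a (map (\<lambda>(v, m). (v, 0)) ps)) + 3 * length (ps :: (nat \<times> nat) list)"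
proof (induction ps arbitrary: a)
  case (Cons p ps)
  then show ?case by (cases p) (auto simp: wide_map_zero)
qed simp

text \<open>A multiple \<open>3 * a + 3\<close> weighs three times its easy record
  \<open>Suc a\<close>. Filling a gap that is not wide also lifts the \<open>length ps\<close>
  larger nonmultiples by 3, which the hard record accounts for.\<close>

lemma sum_list_flat_parts:
  "sum_list (flat_parts a ps) =
   sum_list (flat_parts a (map (\<lambda>(v, m). (v, 0)) ps)) + 3 * sum_mset (flat_record a ps)"
proof (induction a ps rule: flat_record.induct)
  case (2 a v m ps)
  then show ?case
    by (cases m) (auto simp: wide_map_zero sum_list_replicate sum_list_flat_parts_Suc algebra_simps)
qed simp

lemma filter_dvd3_replicate: "filter (\<lambda>x. \<not> 3 dvd x) (replicate m (3 * a + 3 :: nat)) = []"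
  by (simp add: filter_empty_conv)

lemma res3_rev: "res3 (rev xs) = rev (res3 xs)"
  by (simp add: res3_def rev_map rev_filter)

lemma res3_flat_parts: "letters (map fst ps) \<Longrightarrow> res3 (flat_parts a ps) = map fst ps"
proof (induction a ps rule: flat_parts.induct)
  case (2 a v m ps)
  then have "v = 1 \<or> v = 2" by auto
  then have "\<not> 3 dvd (3 * a + v)" "(3 * a + v) mod 3 = v" by presburger+
  with 2 show ?case by (simp add: res3_def filter_dvd3_replicate)
qed (simp add: res3_def)

section \<open>The two scans of \<open>\<Phi>\<^sub>3\<close>\<close>

text \<open>\<open>easy_record\<close> and \<open>hard_gaps\<close> state what the upward scan
  deletes and what it leaves: a wide gap is emptied, and a filled gap that is not wide keeps one
  multiple of 3.\<close>

fun easy_record :: "nat \<Rightarrow> (nat \<times> nat) list \<Rightarrow> nat list" where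
  "easy_record a [] = []"
| "easy_record a ((v, m) # ps) =
    replicate (if wide v ps then m else m - 1) (Suc a) @
      easy_record (if m = 0 \<and> \<not> wide v ps then a else Suc a) ps"

fun hard_gaps :: "(nat \<times> nat) list \<Rightarrow> (nat \<times> nat) list" where
  "hard_gaps [] = []"
| "hard_gaps ((v, m) # ps) = (v, if wide v ps then 0 else min m 1) # hard_gaps ps"

lemma map_fst_hard_gaps [simp]: "map fst (hard_gaps ps) = map fst ps"
  by (induction ps rule: hard_gaps.induct) auto

lemma length_hard_gaps [simp]: "length (hard_gaps ps) = length ps"
  by (induction ps rule: hard_gaps.induct) auto

lemma wide_hard_gaps [simp]: "wide v (hard_gaps ps) \<longleftrightarrow> wide v ps"
  by (simp add: wide_iff_map_fst)

text \<open>An index-free form of the scan: \<open>rev zs\<close> holds the larger parts still to be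
  scanned, \<open>ys\<close> the smaller ones already passed.\<close>

lemma scan_up_step:
  "scan_up (Suc (length zs)) (rev zs @ z # ys) r =
    (if 3 dvd z \<and> flat3 (rev zs @ ys) then scan_up (length zs) (rev zs @ ys) (r @ [z div 3])
     else scan_up (length zs) (rev zs @ z # ys) r)"
proof -
  have "delete_at (length zs) (rev zs @ z # ys) = rev zs @ ys"
    by (simp add: delete_at_def)
  moreover have "(rev zs @ z # ys) ! length zs = z" by (simp add: nth_append)
  ultimately show ?thesis by (simp add: flat_removable_def)
qed

declare scan_up.simps(2) [simp del]

lemma scan_up_replicate:
  assumes "3 dvd z" "\<forall>j<m. flat3 (rev zs @ replicate j z @ ys)"
  shows "scan_up (length zs + m) (rev zs @ replicate m z @ ys) r =
    scan_up (length zs) (rev zs @ ys) (r @ replicate m (z div 3))"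
  using assms(2)
proof (induction m arbitrary: r)
  case (Suc m)
  have "scan_up (length zs + Suc m) (rev zs @ replicate (Suc m) z @ ys) r =
      scan_up (Suc (length (replicate m z @ zs))) (rev (replicate m z @ zs) @ z # ys) r"
    by (simp add: replicate_app_Cons_same add.commute)
  also have "\<dots> = scan_up (length (replicate m z @ zs)) (rev (replicate m z @ zs) @ ys) (r @ [z div 3])"
    using Suc.prems assms(1) by (subst scan_up_step) simp
  also have "\<dots> = scan_up (length zs + m) (rev zs @ replicate m z @ ys) (r @ [z div 3])"
    by (simp add: add.commute)
  also have "\<dots> = scan_up (length zs) (rev zs @ ys) ((r @ [z div 3]) @ replicate m (z div 3))"
    using Suc by simp
  finally show ?case by simp
qed simp

text \<open>The level \<open>b\<close> above the gap is that of the original filling. With one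
  multiple of 3 still present the list is flat; with none, it is flat exactly if the gap is wide or
  was empty. Hence the last multiple of a gap that is not wide resists the upward scan.\<close>

lemma flat3_insert_zeros:
  assumes "letters (map fst ((v, m) # ps))" "flat3 ((3 * a + v) # ys)"
    "b = (if m = 0 \<and> \<not> wide v ps then a else Suc a)"
  shows "m \<noteq> 0 \<Longrightarrow> flat3 (rev (flat_parts b ps) @ replicate (Suc j) (3 * a + 3) @ (3 * a + v) # ys)"
    and "flat3 (rev (flat_parts b ps) @ (3 * a + v) # ys) \<longleftrightarrow> wide v ps \<or> m = 0"
proof -
  have v: "v = 1 \<or> v = 2" using assms(1) by auto
  have hd: "fst (hd ps) = 1 \<or> fst (hd ps) = 2" if "ps \<noteq> []" using assms(1) that by (cases ps) auto
  have l: "letters (map fst ps)" using assms(1) by simp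
  have rep: "rev (flat_parts b ps) @ replicate j z @ (3 * a + v) # ys =
      rev (replicate j z @ flat_parts b ps) @ (3 * a + v) # ys" for j z
    by simp
  show "flat3 (rev (flat_parts b ps) @ replicate (Suc j) (3 * a + 3) @ (3 * a + v) # ys)" if "m \<noteq> 0"
  proof -
    have "successively close3 ((3 * a + 3) # flat_parts b ps)"
      using that hd assms(3) by (intro successively_flat_parts l) (auto simp: close3_def)
    then show ?thesis
      unfolding rep flat3_rev_append_iff using assms(2) v
      by (subst successively_replicate_append) (auto simp: close3_def)
  qed
  have "successively close3 ((3 * a + v) # flat_parts b ps)" if "wide v ps \<or> m = 0"
    using that v hd assms(3) by (intro successively_flat_parts l) (auto simp: close3_def wide_def)
  moreover have "\<not> successively close3 ((3 * a + v) # flat_parts b ps)" if "\<not> (wide v ps \<or> m = 0)"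
  proof -
    have "ps \<noteq> []" "b = Suc a" "v \<le> fst (hd ps)" using that assms(3) by (auto simp: wide_def)
    then show ?thesis
      using hd_flat_parts[of ps b] by (cases "flat_parts b ps") (auto simp: close3_def)
  qed
  ultimately show "flat3 (rev (flat_parts b ps) @ (3 * a + v) # ys) \<longleftrightarrow> wide v ps \<or> m = 0"
    using assms(2) by (auto simp: flat3_rev_append_iff)
qed

lemma flat3_hd: "flat3 (rev zs @ ys) \<Longrightarrow> zs \<noteq> [] \<Longrightarrow> flat3 (hd zs # ys)"
  by (cases zs) (auto simp: flat3_rev_append_iff)

text \<open>\<open>ys\<close> is the lower portion already scanned; the second hypothesis says that
  the smallest unscanned part fits onto it, and is what the induction carries upwards.\<close>

lemma scan_up_flat_parts:
  assumes "letters (map fst ps)" "ps \<noteq> [] \<Longrightarrow> flat3 ((3 * a + fst (hd ps)) # ys)"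
  shows "scan_up (length (flat_parts a ps)) (rev (flat_parts a ps) @ ys) r =
    (rev (flat_parts a (hard_gaps ps)) @ ys, r @ easy_record a ps)"
  using assms
proof (induction a ps arbitrary: ys r rule: easy_record.induct)
  case (2 a v m ps)
  define b where "b = (if m = 0 \<and> \<not> wide v ps then a else Suc a)"
  define zs where "zs = flat_parts b ps"
  define ys' where "ys' = (3 * a + v) # ys"
  let ?Z = "3 * a + 3"
  have v: "v = 1 \<or> v = 2" using 2(2) by auto
  have flat: "flat3 ((3 * a + v) # ys)" using 2(3) by simp
  note ins = flat3_insert_zeros[OF 2(2) flat b_def, folded zs_def ys'_def]
  have ndvd: "\<not> 3 dvd (3 * a + v)" using v by presburger
  have "scan_up (length (flat_parts a ((v, m) # ps))) (rev (flat_parts a ((v, m) # ps)) @ ys) r =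
      scan_up (Suc (length (replicate m ?Z @ zs))) (rev (replicate m ?Z @ zs) @ (3 * a + v) # ys) r"
    by (simp add: zs_def b_def)
  also have "\<dots> = scan_up (length zs + m) (rev zs @ replicate m ?Z @ ys') r"
    using ndvd by (subst scan_up_step) (simp add: ys'_def add.commute)
  also have "\<dots> = (rev (flat_parts a (hard_gaps ((v, m) # ps))) @ ys, r @ easy_record a ((v, m) # ps))"
  proof (cases "wide v ps \<or> m = 0")
    case True
    have "\<forall>j<m. flat3 (rev zs @ replicate j ?Z @ ys')"
    proof (intro allI impI)
      fix j assume "j < m"
      then show "flat3 (rev zs @ replicate j ?Z @ ys')"
        using ins(1)[of "j - 1"] ins(2) True by (cases j) auto
    qed
    then have "scan_up (length zs + m) (rev zs @ replicate m ?Z @ ys') r =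
        scan_up (length zs) (rev zs @ ys') (r @ replicate m (?Z div 3))"
      by (intro scan_up_replicate) auto
    also have "\<dots> = (rev (flat_parts b (hard_gaps ps)) @ ys', (r @ replicate m (?Z div 3)) @ easy_record b ps)"
      unfolding zs_def b_def
    proof (rule 2(1))
      assume "ps \<noteq> []"
      then show "flat3 ((3 * (if m = 0 \<and> \<not> wide v ps then a else Suc a) + fst (hd ps)) # ys')"
        using ins(2) True flat3_hd[of zs ys'] hd_flat_parts[of ps b] by (simp add: zs_def b_def)
    qed (use 2(2) in auto)
    finally show ?thesis using True by (auto simp: ys'_def b_def)
  next
    case False
    then have "m \<noteq> 0" "b = Suc a" by (auto simp: b_def)
    \<comment> \<open>All copies but one are removable because another one remains; the last
      \<open>?Z\<close> then fails the flatness test and stays.\<close>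
    have "\<forall>j<m - 1. flat3 (rev (zs @ []) @ replicate (Suc j) ?Z @ ys')"
      using ins False by auto
    then have "\<forall>j<m - 1. flat3 (rev (?Z # zs) @ replicate j ?Z @ ys')"
      by simp
    then have "scan_up (length (?Z # zs) + (m - 1)) (rev (?Z # zs) @ replicate (m - 1) ?Z @ ys') r =
        scan_up (length (?Z # zs)) (rev (?Z # zs) @ ys') (r @ replicate (m - 1) (?Z div 3))"
      by (intro scan_up_replicate) auto
    also have "\<dots> = scan_up (length zs) (rev zs @ ?Z # ys') (r @ replicate (m - 1) (?Z div 3))"
      using ins(2) False scan_up_step[of zs ?Z ys'] by simp
    also have "\<dots> = (rev (flat_parts b (hard_gaps ps)) @ ?Z # ys',
        (r @ replicate (m - 1) (?Z div 3)) @ easy_record b ps)"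
      unfolding zs_def b_def
    proof (rule 2(1))
      assume "ps \<noteq> []"
      then show "flat3 ((3 * (if m = 0 \<and> \<not> wide v ps then a else Suc a) + fst (hd ps)) # ?Z # ys')"
        using ins(1)[of 0] \<open>m \<noteq> 0\<close> flat3_hd[of zs "?Z # ys'"] hd_flat_parts[of ps b]
        by (simp add: zs_def b_def)
    qed (use 2(2) in auto)
    also have "length (?Z # zs) + (m - 1) = length zs + m" using \<open>m \<noteq> 0\<close> by simp
    also have "rev (?Z # zs) @ replicate (m - 1) ?Z @ ys' = rev zs @ replicate m ?Z @ ys'"
      using \<open>m \<noteq> 0\<close> by (cases m) auto
    finally show ?thesis
      using False \<open>b = Suc a\<close> by (auto simp: ys'_def)
  qed
  finally show ?case .
qed simp

section \<open>The downward scan\<close>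

fun scan_down_record :: "nat \<Rightarrow> nat list \<Rightarrow> nat list" where
  "scan_down_record i [] = []"
| "scan_down_record i (x # xs) =
    (if 3 dvd x then (x div 3 + i) # scan_down_record i xs else scan_down_record (Suc i) xs)"

text \<open>Parts already passed are never tested again, so subtracting 3 from them does not affect
  the record; only their number enters.\<close>

lemma scan_down_eq: "scan_down ps xs r = r @ scan_down_record (length ps) xs"
  by (induction ps xs r rule: scan_down.induct) auto

lemma scan_down_record_append:
  "scan_down_record i (xs @ ys) = scan_down_record i xs @ scan_down_record (i + length (res3 xs)) ys"
  by (induction i xs rule: scan_down_record.induct) (auto simp: res3_def)

text \<open>When the downward scan meets the remaining multiple of a gap, all larger multiples have
  been deleted, so the parts before it are the \<open>length ps\<close> larger nonmultiples.\<close>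

lemma mset_scan_down_record:
  assumes "letters (map fst ps)"
  shows "mset (easy_record a ps) + mset (scan_down_record 0 (rev (flat_parts a (hard_gaps ps)))) =
    flat_record a ps"
  using assms
proof (induction a ps rule: flat_record.induct)
  case (2 a v m ps)
  have v: "v = 1 \<or> v = 2" using 2(4) by auto
  then have ndvd: "\<not> 3 dvd (3 * a + v)" by presburger
  define b where "b = (if m = 0 \<and> \<not> wide v ps then a else Suc a)"
  have len: "length (res3 (rev (flat_parts c (hard_gaps ps)))) = length ps" for c
    using 2(4) by (simp add: res3_rev res3_flat_parts)
  have IH: "mset (easy_record b ps) + mset (scan_down_record 0 (rev (flat_parts b (hard_gaps ps)))) =
    flat_record b ps"
    using 2 by (auto simp: b_def)
  show ?case
    using ndvd len IH by (cases m) (auto simp: scan_down_record_append b_def)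
qed simp

lemma mset_Phi3_record:
  assumes "letters (map fst ps)"
  shows "mset (Phi3_record (rev (flat_parts 0 ps))) = flat_record 0 ps"
proof -
  have "flat3 [3 * 0 + fst (hd ps)]" if "ps \<noteq> []" using assms that by (cases ps) auto
  then have "scan_up (length (flat_parts 0 ps)) (rev (flat_parts 0 ps) @ []) [] =
      (rev (flat_parts 0 (hard_gaps ps)) @ [], [] @ easy_record 0 ps)"
    by (intro scan_up_flat_parts assms)
  then show ?thesis
    using mset_scan_down_record[OF assms, of 0] by (simp add: Phi3_record_def scan_down_eq)
qed

section \<open>Stockhofe's bijection modulo 3\<close>

lemma ex1_among_three:
  assumes "a = f x \<or> a = f y \<or> a = f z" "f x \<noteq> f y" "f x \<noteq> f z" "f y \<noteq> f z"
  shows "\<exists>!c. c \<in> {x, y, z} \<and> f c = a"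
  unfolding Ex1_def insert_iff empty_iff using assms by metis

lemma mod_Suc_distinct3:
  fixes h :: nat
  shows "h mod 3 \<noteq> (h + 1) mod 3" "h mod 3 \<noteq> (h + 2) mod 3" "(h + 1) mod 3 \<noteq> (h + 2) mod 3"
  unfolding add_2_eq_Suc' Suc_eq_plus1[symmetric] mod_Suc by simp_all

lemma mod_Suc_exhaust3:
  fixes h v :: nat
  shows "v mod 3 = h mod 3 \<or> v mod 3 = (h + 1) mod 3 \<or> v mod 3 = (h + 2) mod 3"
proof -
  have "v mod 3 < 3" "h mod 3 < 3" by simp_all
  then have "v mod 3 = 0 \<or> v mod 3 = 1 \<or> v mod 3 = 2" "h mod 3 = 0 \<or> h mod 3 = 1 \<or> h mod 3 = 2"
    by linarith+
  then show ?thesis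
    unfolding add_2_eq_Suc' Suc_eq_plus1[symmetric] mod_Suc by (elim disjE) simp_all
qed

lemma the_residue:
  fixes h v :: nat
  shows "(THE c. c \<in> {h, h + 1, h + 2} \<and> c mod 3 = v mod 3) \<in> {h, h + 1, h + 2} \<and>
    (THE c. c \<in> {h, h + 1, h + 2} \<and> c mod 3 = v mod 3) mod 3 = v mod 3"
  by (rule theI'[OF ex1_among_three[where f = "\<lambda>c. c mod 3", OF mod_Suc_exhaust3 mod_Suc_distinct3]])

lemma residue_core_Cons:
  assumes "vs \<noteq> []"
  obtains c where "residue_core (v # vs) = c # residue_core vs"
    "close3 (hd (residue_core vs)) c" "c mod 3 = v mod 3"
proof -
  obtain w ws where "vs = w # ws" using assms by (cases vs) auto
  then show ?thesis
    using the_residue[of "hd (residue_core vs)" v] that by (force simp: Let_def close3_def)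
qed

lemma residue_core_props:
  assumes "letters vs"
  shows length_residue_core: "length (residue_core vs) = length vs"
    and flat3_residue_core: "flat3 (residue_core vs)"
    and mod_residue_core: "map (\<lambda>c. c mod 3) (residue_core vs) = vs"
proof -
  have "length (residue_core vs) = length vs \<and> flat3 (residue_core vs) \<and>
      map (\<lambda>c. c mod 3) (residue_core vs) = vs"
    using assms
  proof (induction vs)
    case (Cons v vs)
    show ?case
    proof (cases "vs = []")
      case False
      obtain c where "residue_core (v # vs) = c # residue_core vs"
        "close3 (hd (residue_core vs)) c" "c mod 3 = v mod 3"
        using residue_core_Cons[OF False] .
      moreover have "residue_core vs \<noteq> []" using Cons False by auto
      moreover have "v mod 3 = v" using Cons.prems by auto
      ultimately show ?thesis using Cons by (auto simp: flat3_Cons)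
    qed (use Cons.prems in auto)
  qed simp
  then show "length (residue_core vs) = length vs" "flat3 (residue_core vs)"
    "map (\<lambda>c. c mod 3) (residue_core vs) = vs" by auto
qed

lemma map_snd_zero: "sum_list (map snd ps) = (0::nat) \<Longrightarrow> map (\<lambda>(v, m). (v, 0)) ps = ps"
  by (induction ps) auto

text \<open>The core is 3-flat, hence has a code with the same letters, and its length leaves no
  room for multiples of 3.\<close>

lemma residue_core_eq_flat_parts:
  fixes ps :: "(nat \<times> nat) list"
  assumes "letters (map fst ps)"
  shows "residue_core (rev (map fst ps)) = rev (flat_parts 0 (map (\<lambda>(v, m). (v, 0)) ps))"
proof -
  define c where "c = residue_core (rev (map fst ps))"
  have l: "letters (rev (map fst ps))" using assms by simp
  obtain qs where qs: "letters (map fst qs)" "c = rev (flat_parts 0 qs)"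
    using flat3_residue_core[OF l] flat3_obtain c_def by metis
  have mod: "map (\<lambda>c. c mod 3) c = rev (map fst ps)"
    unfolding c_def by (rule mod_residue_core[OF l])
  have "\<not> 3 dvd x" if "x \<in> set c" for x
  proof -
    have "x mod 3 \<in> set (map (\<lambda>c. c mod 3) c)" using that by auto
    then have "x mod 3 \<in> {1, 2}" unfolding mod using l by blast
    then show ?thesis by auto
  qed
  then have "filter (\<lambda>x. \<not> 3 dvd x) c = c" by simp
  then have "res3 c = rev (map fst ps)" using mod by (simp add: res3_def)
  then have eq: "map fst qs = map fst ps" using qs by (simp add: res3_rev res3_flat_parts)
  have "length c = length ps" using length_residue_core[OF l] by (simp add: c_def)
  then have "sum_list (map snd qs) = 0"
    using map_eq_imp_length_eq[OF eq] by (simp add: qs length_flat_parts)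
  then have zero: "map (\<lambda>(v, m). (v, 0)) qs = qs" by (rule map_snd_zero)
  have map_fst: "map (\<lambda>(v, m). (v, 0::nat)) rs = map (\<lambda>v. (v, 0)) (map fst rs)" for rs :: "(nat \<times> nat) list"
    by auto
  have "map (\<lambda>(v, m). (v, 0::nat)) ps = map (\<lambda>(v, m). (v, 0)) qs"
    unfolding map_fst[of ps] map_fst[of qs] eq ..
  with zero qs(2) show ?thesis by (simp only: c_def)
qed

text \<open>Records are at most \<open>length ps\<close>, so the conjugated record is no longer than
  the core; its entry at position \<open>i\<close> counts the records above
  \<open>i\<close>.\<close>

lemma Phi3_flat_parts:
  assumes "letters (map fst ps)"
  shows "Phi3 (rev (flat_parts 0 ps)) =
    map (\<lambda>i. residue_core (rev (map fst ps)) ! i + 3 * size (filter_mset (\<lambda>r. i < r) (flat_record 0 ps)))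
      [0..<length ps]"
proof -
  define R where "R = sort_desc (Phi3_record (rev (flat_parts 0 ps)))"
  define c where "c = residue_core (rev (map fst ps))"
  have R: "mset R = flat_record 0 ps" by (simp add: R_def mset_Phi3_record[OF assms])
  have part: "partition R" by (simp add: R_def)
  have "set R \<subseteq> {0<..length ps}"
    using set_flat_record[of 0 ps] R by (metis add_0 set_mset_mset)
  then have "length (conjugate R) \<le> length ps"
    by (cases R) (auto simp: length_conjugate)
  moreover have lc: "length c = length ps"
    unfolding c_def using assms by (simp add: length_residue_core)
  moreover have "Phi3 (rev (flat_parts 0 ps)) = add_3_times c (conjugate R)"
    using assms by (simp add: Phi3_def R_def c_def res3_rev res3_flat_parts)
  moreover have "length (filter (\<lambda>r. i < r) R) = size (filter_mset (\<lambda>r. i < r) (flat_record 0 ps))" for i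
    by (metis R mset_filter size_mset)
  ultimately show ?thesis
    by (auto simp: add_3_times_def nth_default_conjugate[OF part] nth_default_nth max_absorb1 c_def[symmetric])
qed

definition B3 :: "nat \<Rightarrow> nat list set" where
  "B3 N = {xs. pos_partition xs \<and> sum_list xs = N \<and> (\<forall>x\<in>set xs. \<not> 3 dvd x)}"

lemma B3_sum_list: "ys \<in> B3 N \<Longrightarrow> sum_list ys = N"
  by (simp add: B3_def)

lemma mod3_letters: "\<forall>x\<in>set xs. \<not> 3 dvd x \<Longrightarrow> letters (map (\<lambda>x. x mod 3) xs)"
proof
  fix y assume "\<forall>x\<in>set xs. \<not> 3 dvd x" "y \<in> set (map (\<lambda>x. x mod 3) xs)"
  then obtain x where "\<not> 3 dvd x" "y = x mod 3" by auto
  then show "y \<in> {1, 2}" by simp presburger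
qed

lemma res3_regular: "\<forall>x\<in>set xs. \<not> 3 dvd x \<Longrightarrow> res3 xs = map (\<lambda>x. x mod 3) xs"
  by (simp add: res3_def)

lemma size_filter_antimono:
  "i \<le> j \<Longrightarrow> size (filter_mset (\<lambda>r. j < r) M) \<le> size (filter_mset (\<lambda>r. (i::nat) < r) M)"
  by (intro size_mset_mono filter_mset_mono_strong) auto

text \<open>Adding multiples of 3 keeps the residues of the core, and the weight follows from
  \<open>sum_list_flat_parts\<close> by summing the record over its columns.\<close>

lemma Phi3_flat_parts_props:
  assumes "letters (map fst ps)"
  shows "res3 (Phi3 (rev (flat_parts 0 ps))) = rev (map fst ps)"
    and "Phi3 (rev (flat_parts 0 ps)) \<in> B3 (sum_list (flat_parts 0 ps))"
proof -
  define c where "c = residue_core (rev (map fst ps))"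
  define M where "M = flat_record 0 ps"
  define q where "q i = size (filter_mset (\<lambda>r. i < r) M)" for i
  define k where "k = length ps"
  define \<beta> where "\<beta> = map (\<lambda>i. c ! i + 3 * q i) [0..<k]"
  have \<beta>: "Phi3 (rev (flat_parts 0 ps)) = \<beta>"
    using Phi3_flat_parts[OF assms] by (simp add: \<beta>_def c_def M_def q_def k_def)
  have l: "letters (rev (map fst ps))" using assms by simp
  have c: "length c = k" "flat3 c" "map (\<lambda>c. c mod 3) c = rev (map fst ps)"
    using length_residue_core[OF l] flat3_residue_core[OF l] mod_residue_core[OF l]
    by (simp_all add: c_def k_def)
  have "map (\<lambda>x. x mod 3) \<beta> = map (\<lambda>i. c ! i mod 3) [0..<length c]"
    by (simp add: \<beta>_def c(1))
  also have "\<dots> = map (\<lambda>c. c mod 3) c"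
    by (rule nth_equalityI) simp_all
  finally have mod: "map (\<lambda>x. x mod 3) \<beta> = rev (map fst ps)" using c by simp
  have ndvd: "\<forall>x\<in>set \<beta>. \<not> 3 dvd x"
  proof
    fix x assume "x \<in> set \<beta>"
    then have "x mod 3 \<in> set (map (\<lambda>x. x mod 3) \<beta>)" by auto
    then have "x mod 3 \<in> {1, 2}" unfolding mod using l by blast
    then show "\<not> 3 dvd x" by auto
  qed
  then show "res3 (Phi3 (rev (flat_parts 0 ps))) = rev (map fst ps)"
    by (simp add: \<beta> mod res3_regular)
  have "partition \<beta>"
  proof -
    have "c ! j + 3 * q j \<le> c ! i + 3 * q i" if "i < j" "j < k" for i j
    proof -
      have "c ! j \<le> c ! i"
        using c that by (auto simp: flat3_def pos_partition_def partition_def sorted_wrt_iff_nth_less)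
      moreover have "q j \<le> q i" unfolding q_def using that by (intro size_filter_antimono) simp
      ultimately show ?thesis by simp
    qed
    then show ?thesis by (simp add: \<beta>_def partition_def sorted_wrt_iff_nth_less)
  qed
  moreover have "0 < x" if "x \<in> set \<beta>" for x using ndvd that by (cases x) auto
  moreover have "sum_list \<beta> = sum_list (flat_parts 0 ps)"
  proof -
    obtain xs where xs: "mset xs = M" using ex_mset by blast
    have "\<forall>x\<in>set xs. x \<le> k"
      using set_flat_record[of 0 ps] xs by (metis M_def add_0 greaterThanAtMost_iff k_def set_mset_mset subsetD)
    then have "(\<Sum>i<k. length (filter (\<lambda>x. i < x) xs)) = sum_list xs"
      by (rule sum_length_filter_less)
    moreover have "length (filter (\<lambda>x. i < x) xs) = q i" for i
      by (metis xs mset_filter size_mset q_def)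
    ultimately have "(\<Sum>i<k. q i) = sum_mset M"
      by (simp add: sum_mset_sum_list flip: xs)
    moreover have "sum_list \<beta> = (\<Sum>i<k. c ! i) + 3 * (\<Sum>i<k. q i)"
      by (simp add: \<beta>_def interv_sum_list_conv_sum_set_nat atLeast0LessThan sum.distrib sum_distrib_left)
    moreover have "(\<Sum>i<k. c ! i) = sum_list c"
      by (simp add: sum_list_sum_nth c atLeast0LessThan)
    moreover have "sum_list c = sum_list (flat_parts 0 (map (\<lambda>(v, m). (v, 0)) ps))"
      using residue_core_eq_flat_parts[OF assms] by (simp add: c_def)
    ultimately show ?thesis
      using sum_list_flat_parts[of 0 ps] by (simp add: M_def)
  qed
  ultimately show "Phi3 (rev (flat_parts 0 ps)) \<in> B3 (sum_list (flat_parts 0 ps))"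
    using ndvd by (simp add: \<beta> B3_def pos_partition_def)
qed

lemma count_eq_size_filter_diff:
  "count M (Suc i) = size (filter_mset (\<lambda>r. i < r) M) - size (filter_mset (\<lambda>r. Suc i < r) M)"
proof -
  obtain xs where "mset xs = M" using ex_mset by blast
  then show ?thesis
    using count_list_Suc[of xs i] by (metis count_mset mset_filter size_mset)
qed

text \<open>Equal images have equal residue sequences, hence equal letters and cores. Subtracting
  the core leaves the counts of records above each \<open>i\<close>, which determine the record and
  then the code.\<close>

lemma Phi3_inj:
  assumes "flat3 xs" "flat3 ys" "Phi3 xs = Phi3 ys"
  shows "xs = ys"
proof -
  obtain ps where ps: "letters (map fst ps)" "xs = rev (flat_parts 0 ps)"
    using flat3_obtain[OF assms(1)] .
  obtain qs where qs: "letters (map fst qs)" "ys = rev (flat_parts 0 qs)"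
    using flat3_obtain[OF assms(2)] .
  have fst: "map fst ps = map fst qs"
    using Phi3_flat_parts_props(1) ps qs assms(3) by (metis rev_is_rev_conv)
  then have len: "length ps = length qs" by (rule map_eq_imp_length_eq)
  let ?s = "\<lambda>ps i. size (filter_mset (\<lambda>r. i < r) (flat_record 0 ps))"
  have "?s ps i = ?s qs i" for i
  proof (cases "i < length ps")
    case True
    have "Phi3 xs ! i = Phi3 ys ! i" using assms(3) by simp
    then show ?thesis
      using True len unfolding ps(2) qs(2) Phi3_flat_parts[OF ps(1)] Phi3_flat_parts[OF qs(1)] fst by simp
  next
    case False
    have "filter_mset (\<lambda>r. i < r) (flat_record 0 ps) = {#}" if "length ps \<le> i" for ps
    proof (rule multiset_eqI)
      show "count (filter_mset (\<lambda>r. i < r) (flat_record 0 ps)) x = count {#} x" for x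
        using that count_flat_record_gt[of 0 ps x] by simp
    qed
    from this[of ps] this[of qs] show ?thesis using False len by (metis not_le_imp_less)
  qed
  then have "count (flat_record 0 ps) (Suc i) = count (flat_record 0 qs) (Suc i)" for i
    by (simp only: count_eq_size_filter_diff)
  then have "count (flat_record 0 ps) r = count (flat_record 0 qs) r" for r
    by (cases r) (simp_all add: count_flat_record_le)
  then have "flat_record 0 ps = flat_record 0 qs" by (rule multiset_eqI)
  then have "ps = qs" by (rule flat_record_inj[OF fst])
  then show ?thesis using ps qs by simp
qed

text \<open>Core parts step by at most 2. As \<open>x\<close> is at least the next part, its
  quotient \<open>k\<close> satisfies \<open>3 * (k - hd q) \<ge> - 2\<close>, hence
  \<open>k \<ge> hd q\<close>: the quotients decrease weakly.\<close>

lemma residue_core_quotient: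
  assumes "pos_partition xs" "\<forall>x\<in>set xs. \<not> 3 dvd x"
  shows "\<exists>q. partition q \<and> length q = length xs \<and>
    xs = map2 (\<lambda>c d. c + 3 * d) (residue_core (map (\<lambda>x. x mod 3) xs)) q"
  using assms
proof (induction xs)
  case (Cons x xs)
  have "pos_partition xs" "\<forall>x\<in>set xs. \<not> 3 dvd x"
    using Cons.prems by (auto simp: pos_partition_def)
  from Cons.IH[OF this] obtain q where q: "partition q" "length q = length xs"
    "xs = map2 (\<lambda>c d. c + 3 * d) (residue_core (map (\<lambda>x. x mod 3) xs)) q"
    by blast
  show ?case
  proof (cases "xs = []")
    case True
    then show ?thesis by (intro exI[of _ "[x div 3]"]) simp
  next
    case False
    let ?c = "residue_core (map (\<lambda>x. x mod 3) xs)"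
    obtain c where c: "residue_core (x mod 3 # map (\<lambda>x. x mod 3) xs) = c # ?c"
      "close3 (hd ?c) c" "c mod 3 = x mod 3"
    proof (rule residue_core_Cons[of "map (\<lambda>x. x mod 3) xs" "x mod 3"])
      show "map (\<lambda>x. x mod 3) xs \<noteq> []" using False by simp
    qed simp
    have "letters (map (\<lambda>x. x mod 3) xs)" using Cons.prems(2) by (intro mod3_letters) auto
    then have "length ?c = length xs" by (simp add: length_residue_core)
    then have "?c \<noteq> []" "q \<noteq> []" using q(2) False by auto
    then have "hd (map2 (\<lambda>c d. c + 3 * d) ?c q) = hd ?c + 3 * hd q"
      by (cases ?c; cases q) auto
    then have "hd xs = hd ?c + 3 * hd q" using q(3) by argo
    moreover have "hd xs \<le> x" using Cons.prems False by (auto simp: pos_partition_def)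
    ultimately have "hd ?c + 3 * hd q \<le> x" by simp
    moreover have "hd ?c \<le> c" "c \<le> hd ?c + 2" using c(2) by (auto simp: close3_def)
    \<comment> \<open>Integers, because \<open>c \<le> x\<close> is known only after
      \<open>k\<close> has been bounded below.\<close>
    moreover have "(int x - int c) mod 3 = 0"
      using c(3) by (metis mod_eq_dvd_iff dvd_imp_mod_0 zmod_int of_nat_numeral)
    then obtain k where k: "int x - int c = 3 * k" by auto
    ultimately have "k \<ge> int (hd q)" by linarith
    then have x: "x = c + 3 * nat k" and hd: "hd q \<le> nat k" using k by auto
    have "partition (nat k # q)"
      using q(1) hd partition_le_hd[OF q(1)] by (meson le_trans partition_Cons)
    moreover have "x # xs = map2 (\<lambda>c d. c + 3 * d) (c # ?c) (nat k # q)"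
      unfolding zip_Cons_Cons list.map prod.case q(3)[symmetric] by (simp only: x)
    moreover have "length (nat k # q) = length (x # xs)" using q(2) by simp
    ultimately show ?thesis
      unfolding list.map(2) c(1) by (intro exI[of _ "nat k # q"] conjI)
  qed
next
  case Nil
  show ?case by (rule exI[of _ "[]"]) simp
qed

text \<open>The quotients over the core form a partition \<open>q\<close>. Its conjugate is the
  required record, and \<open>flat_record_surj\<close> finds the code with that record and the
  residues of \<open>ys\<close>.\<close>

lemma Phi3_surj:
  assumes "ys \<in> B3 N"
  shows "\<exists>xs. flat3 xs \<and> Phi3 xs = ys"
proof -
  define vs where "vs = map (\<lambda>x. x mod 3) ys"
  have ys: "pos_partition ys" "\<forall>x\<in>set ys. \<not> 3 dvd x" using assms by (auto simp: B3_def)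
  from residue_core_quotient[OF ys, folded vs_def] obtain q where
    "partition q \<and> length q = length ys \<and> ys = map2 (\<lambda>c d. c + 3 * d) (residue_core vs) q" ..
  then have q: "partition q" "length q = length ys" "ys = map2 (\<lambda>c d. c + 3 * d) (residue_core vs) q"
    by blast+
  have l: "letters vs" unfolding vs_def using mod3_letters[OF ys(2)] .
  define M where "M = mset (conjugate q)"
  have "set_mset M \<subseteq> {0<..0 + length (rev vs)}"
  proof -
    have "x \<le> length q" if "x \<in> set (conjugate q)" for x
      using that by (auto simp: conjugate_def split: if_splits)
    then show ?thesis
      using pos_partition_conjugate[OF q(1)] q(2) by (auto simp: M_def vs_def pos_partition_def)
  qed
  then obtain ps where ps: "map fst ps = rev vs" "flat_record 0 ps = M"
    using flat_record_surj by blast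
  have l': "letters (map fst ps)" using l ps by simp
  have len: "length ps = length ys" using ps(1) by (metis length_map length_rev vs_def)
  have "size (filter_mset (\<lambda>r. i < r) M) = q ! i" if "i < length ys" for i
    using that q(2) length_filter_conjugate[OF q(1), of i]
    by (simp add: M_def nth_default_nth flip: mset_filter)
  then have "Phi3 (rev (flat_parts 0 ps)) = map (\<lambda>i. residue_core vs ! i + 3 * q ! i) [0..<length ys]"
    unfolding Phi3_flat_parts[OF l'] by (simp add: ps len)
  also have "\<dots> = ys"
  proof (rule nth_equalityI)
    fix i assume "i < length (map (\<lambda>i. residue_core vs ! i + 3 * q ! i) [0..<length ys])"
    then have i: "i < length ys" by simp
    have "ys ! i = map2 (\<lambda>c d. c + 3 * d) (residue_core vs) q ! i" by (rule arg_cong[OF q(3)])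
    also have "\<dots> = residue_core vs ! i + 3 * q ! i"
      using i q(2) length_residue_core[OF l] by (simp add: vs_def)
    finally show "map (\<lambda>i. residue_core vs ! i + 3 * q ! i) [0..<length ys] ! i = ys ! i"
      using i by simp
  qed simp
  finally show ?thesis using flat3_rev_flat_parts[OF l'] by blast
qed

lemma Phi3_in_B3:
  assumes "flat3 xs"
  shows "Phi3 xs \<in> B3 (sum_list xs)" "res3 (Phi3 xs) = res3 xs"
proof -
  obtain ps where ps: "letters (map fst ps)" "xs = rev (flat_parts 0 ps)"
    using flat3_obtain[OF assms] .
  then show "Phi3 xs \<in> B3 (sum_list xs)" "res3 (Phi3 xs) = res3 xs"
    using Phi3_flat_parts_props[OF ps(1)] by (simp_all add: res3_rev res3_flat_parts)
qed

text \<open>\<open>Phi3_inv\<close> searches only among partitions of the weight of its argument,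
  which suffices because \<open>Phi3\<close> preserves the weight.\<close>

lemma Phi3_inv_Phi3:
  assumes "flat3 xs"
  shows "Phi3_inv (Phi3 xs) = xs"
  unfolding Phi3_inv_def
proof (rule the_inv_into_f_f)
  show "inj_on Phi3 {zs. flat3 zs \<and> sum_list zs = sum_list (Phi3 xs)}"
    by (rule inj_onI) (blast intro: Phi3_inj)
  show "xs \<in> {zs. flat3 zs \<and> sum_list zs = sum_list (Phi3 xs)}"
    using assms B3_sum_list[OF Phi3_in_B3(1)[OF assms]] by simp
qed

definition B3_res2 :: "nat \<Rightarrow> nat list set" where
  "B3_res2 N = {xs \<in> B3 N. xs \<noteq> [] \<and> hd xs mod 3 = 2}"

text \<open>In a 3-regular partition the first nonzero residue is that of the largest part, and
  \<open>Phi3\<close> preserves the residue sequence.\<close>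

lemma bij_betw_Phi3_inv: "bij_betw Phi3_inv (B3_res2 N) (flat3_res2 N)"
proof (rule bij_betw_byWitness[where f' = Phi3])
  have obt: "\<exists>xs. flat3 xs \<and> sum_list xs = N \<and> Phi3 xs = ys" if ys: "ys \<in> B3 N" for ys
  proof -
    obtain xs where xs: "flat3 xs" "Phi3 xs = ys" using Phi3_surj[OF ys] by blast
    then have "sum_list xs = N"
      using B3_sum_list[OF Phi3_in_B3(1)[OF xs(1)]] B3_sum_list[OF ys] by simp
    with xs show ?thesis by blast
  qed
  have res: "ys \<noteq> [] \<and> hd ys mod 3 = 2 \<longleftrightarrow> res3 ys \<noteq> [] \<and> hd (res3 ys) = 2" if "ys \<in> B3 N" for ys
  proof -
    have "res3 ys = map (\<lambda>x. x mod 3) ys" using that unfolding B3_def by (intro res3_regular) blast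
    then show ?thesis by (cases ys) simp_all
  qed
  show "\<forall>ys\<in>B3_res2 N. Phi3 (Phi3_inv ys) = ys"
    using obt Phi3_inv_Phi3 unfolding B3_res2_def by fastforce
  show "\<forall>xs\<in>flat3_res2 N. Phi3_inv (Phi3 xs) = xs"
    using Phi3_inv_Phi3 by (simp add: flat3_res2_def)
  show "Phi3_inv ` B3_res2 N \<subseteq> flat3_res2 N"
  proof
    fix xs assume "xs \<in> Phi3_inv ` B3_res2 N"
    then obtain ys where ys: "ys \<in> B3_res2 N" "xs = Phi3_inv ys" by blast
    then obtain zs where zs: "flat3 zs" "sum_list zs = N" "Phi3 zs = ys"
      using obt unfolding B3_res2_def by blast
    then have "xs = zs" "res3 ys = res3 zs"
      using ys Phi3_inv_Phi3[of zs] Phi3_in_B3(2)[of zs] by simp_all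
    then show "xs \<in> flat3_res2 N"
      using zs ys(1) res[of ys] unfolding flat3_res2_def B3_res2_def by simp
  qed
  show "Phi3 ` flat3_res2 N \<subseteq> B3_res2 N"
  proof
    fix ys assume "ys \<in> Phi3 ` flat3_res2 N"
    then obtain xs where "xs \<in> flat3_res2 N" "ys = Phi3 xs" by blast
    then show "ys \<in> B3_res2 N"
      using Phi3_in_B3[of xs] res[of ys] by (simp add: flat3_res2_def B3_res2_def)
  qed
qed

section \<open>Glaisher's bijection\<close>

lemma multiplicity3_power_mult:
  fixes u :: nat
  assumes "\<not> 3 dvd u"
  shows "multiplicity 3 (3 ^ a * u) = a"
proof (rule multiplicity_eqI)
  show "\<not> 3 ^ Suc a dvd 3 ^ a * u"
    using assms by (simp add: mult.commute[of 3])
qed simp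

lemma obtain_multiplicity3:
  fixes t :: nat
  assumes "0 < t"
  obtains a u where "t = 3 ^ a * u" "\<not> 3 dvd u"
proof -
  have "\<not> 3 dvd t div 3 ^ multiplicity 3 t" using assms by (intro multiplicity_decompose) auto
  moreover have "t = 3 ^ multiplicity 3 t * (t div 3 ^ multiplicity 3 t)"
    by (simp add: multiplicity_dvd)
  ultimately show ?thesis using that by blast
qed

lemma split3_power_mult: "\<not> 3 dvd u \<Longrightarrow> split3 (3 ^ a * u) = replicate (3 ^ a) u"
  by (simp add: split3_def multiplicity3_power_mult)

lemma sum_list_split3: "0 < t \<Longrightarrow> sum_list (split3 t) = t"
  by (rule obtain_multiplicity3[of t]) (auto simp: split3_power_mult sum_list_replicate)

lemma split3_elems: "0 < t \<Longrightarrow> u \<in> set (split3 t) \<Longrightarrow> \<not> 3 dvd u \<and> u \<le> t"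
  by (rule obtain_multiplicity3[of t]) (auto simp: split3_power_mult)

lemma count_split3:
  assumes "0 < t" "\<not> 3 dvd u" "\<And>a. 3 ^ a * u = t \<Longrightarrow> a \<le> A"
  shows "count_list (split3 t) u = (\<Sum>a\<le>A. if 3 ^ a * u = t then 3 ^ a else 0)"
proof -
  obtain b w where t: "t = 3 ^ b * w" "\<not> 3 dvd w" using obtain_multiplicity3[OF assms(1)] .
  have eq: "3 ^ a * u = t \<longleftrightarrow> w = u \<and> a = b" for a
    using multiplicity3_power_mult[OF assms(2), of a] multiplicity3_power_mult[OF t(2), of b] t(1)
    by (metis mult_left_cancel power_not_zero zero_neq_numeral)
  show ?thesis
  proof (cases "w = u")
    case True
    then have "b \<le> A" using assms(3) t by simp
    then show ?thesis unfolding eq using True assms(2) by (simp add: t split3_power_mult sum.delta count_list_replicate)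
  next
    case False
    then show ?thesis unfolding eq by (simp add: t split3_power_mult count_list_replicate)
  qed
qed

text \<open>Each part \<open>3 ^ a * u\<close> yields \<open>3 ^ a\<close> copies of
  \<open>u\<close>, so the multiplicity of \<open>u\<close> after splitting is a ternary expansion
  whose digits are the multiplicities before. A common bound \<open>A\<close> lets two partitions be
  compared digit by digit.\<close>

lemma count_concat_split3:
  assumes "\<forall>t\<in>set xs. 0 < t" "\<not> 3 dvd u" "\<And>a. 3 ^ a * u \<in> set xs \<Longrightarrow> a \<le> A"
  shows "count_list (concat (map split3 xs)) u = (\<Sum>a\<le>A. 3 ^ a * count_list xs (3 ^ a * u))"
  using assms(1,3)
proof (induction xs)
  case (Cons x xs)
  have "count_list (split3 x) u = (\<Sum>a\<le>A. if 3 ^ a * u = x then 3 ^ a else 0)"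
    using Cons.prems assms(2) by (intro count_split3) auto
  moreover have "count_list (concat (map split3 xs)) u = (\<Sum>a\<le>A. 3 ^ a * count_list xs (3 ^ a * u))"
    using Cons by auto
  moreover have "(if 3 ^ a * u = x then 3 ^ a else 0) + 3 ^ a * count_list xs (3 ^ a * u) =
      3 ^ a * count_list (x # xs) (3 ^ a * u)" for a
    by (simp add: algebra_simps)
  ultimately show ?case by (simp add: sum.distrib[symmetric])
qed simp

text \<open>The units digit is read modulo 3, then the rest is divided by 3. The digit at
  \<open>A\<close> takes whatever is left and may be arbitrarily large.\<close>

lemma ternary_unique:
  fixes f g :: "nat \<Rightarrow> nat"
  assumes "(\<Sum>a\<le>A. 3 ^ a * f a) = (\<Sum>a\<le>A. 3 ^ a * g a)" "\<forall>a<A. f a \<le> 2" "\<forall>a<A. g a \<le> 2" "a \<le> A"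
  shows "f a = g a"
  using assms
proof (induction A arbitrary: a f g)
  case (Suc A)
  have shift: "(\<Sum>a\<le>Suc A. 3 ^ a * h a) = h 0 + 3 * (\<Sum>a\<le>A. 3 ^ a * h (Suc a))" for h :: "nat \<Rightarrow> nat"
    by (simp only: sum.atMost_Suc_shift) (simp add: sum_distrib_left mult.assoc)
  have eq: "f 0 + 3 * (\<Sum>a\<le>A. 3 ^ a * f (Suc a)) = g 0 + 3 * (\<Sum>a\<le>A. 3 ^ a * g (Suc a))"
    using Suc.prems(1) by (simp only: shift)
  have "f 0 \<le> 2" "g 0 \<le> 2" using Suc.prems by auto
  moreover have "f 0 mod 3 = g 0 mod 3" using arg_cong[OF eq, of "\<lambda>n. n mod 3"] by simp
  ultimately have zero: "f 0 = g 0" by simp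
  then have sums: "(\<Sum>a\<le>A. 3 ^ a * f (Suc a)) = (\<Sum>a\<le>A. 3 ^ a * g (Suc a))"
    using eq by simp
  have "f (Suc b) = g (Suc b)" if "b \<le> A" for b
    using Suc.IH[OF sums] Suc.prems(2,3) that by simp
  then show ?case using zero Suc.prems(4) by (cases a) auto
qed simp

lemma ternary_exists:
  fixes m :: nat
  shows "\<exists>f. (\<Sum>a\<le>A. 3 ^ a * f a) = m \<and> (\<forall>a<A. f a \<le> 2)"
proof (induction A arbitrary: m)
  case 0
  show ?case by (intro exI[of _ "\<lambda>_. m"]) simp
next
  case (Suc A)
  obtain f where f: "(\<Sum>a\<le>A. 3 ^ a * f a) = m div 3" "\<forall>a<A. f a \<le> 2" using Suc by blast
  have "(\<Sum>a\<le>Suc A. 3 ^ a * case_nat (m mod 3) f a) = m mod 3 + 3 * (\<Sum>a\<le>A. 3 ^ a * f a)"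
    by (simp only: sum.atMost_Suc_shift) (simp add: sum_distrib_left mult.assoc)
  also have "\<dots> = m" unfolding f(1) by simp
  finally show ?case
    using f(2) by (intro exI[of _ "case_nat (m mod 3) f"]) (auto split: nat.split simp: less_Suc_eq_le[symmetric])
qed

text \<open>
  Below the exponent \<open>top_exp J u\<close> the multiplicities of the parts \<open>3 ^ a * u\<close> are ternary digits; at
  this exponent the multiplicity is unrestricted, and beyond it the parts exceed \<open>3 * J\<close>.
\<close>

definition top_exp :: "nat \<Rightarrow> nat \<Rightarrow> nat" where
  "top_exp J u = (LEAST a. J < 3 ^ a * u)"

lemma top_exp:
  assumes "0 < u"
  shows "a < top_exp J u \<Longrightarrow> 3 ^ a * u \<le> J"
    and "3 ^ a * u \<le> 3 * J \<Longrightarrow> a \<le> top_exp J u"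
    and "u \<le> 3 * J \<Longrightarrow> a \<le> top_exp J u \<Longrightarrow> 3 ^ a * u \<le> 3 * J"
    and "3 ^ a * u \<le> J \<Longrightarrow> a < top_exp J u"
proof -
  \<comment> \<open>The exponent \<open>J\<close> witnesses that the minimum defining
    \<open>top_exp\<close> exists.\<close>
  have "J < 3 ^ J" by (rule less_exp[THEN order.strict_trans2]) (simp add: power_mono)
  also have "\<dots> \<le> 3 ^ J * u" using assms by simp
  finally have top: "J < 3 ^ top_exp J u * u" unfolding top_exp_def by (rule LeastI)
  show low: "3 ^ a * u \<le> J" if "a < top_exp J u" for a
    using not_less_Least[OF that[unfolded top_exp_def]] by simp
  have mono: "J < 3 ^ a * u" if "top_exp J u \<le> a" for a
    using top that by (meson le_refl less_le_trans mult_le_mono one_le_numeral power_increasing)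
  show "a \<le> top_exp J u" if "3 ^ a * u \<le> 3 * J"
  proof (rule ccontr)
    assume "\<not> a \<le> top_exp J u"
    then obtain b where "a = Suc b" "top_exp J u \<le> b" by (cases a) auto
    with mono[of b] that show False by simp
  qed
  show "a < top_exp J u" if "3 ^ a * u \<le> J" using mono that by (meson linorder_not_le)
  \<comment> \<open>The exponent one lower gives at most \<open>J\<close>, and tripling gives
    \<open>3 * J\<close>; for exponent 0 the bound is the assumption on \<open>u\<close>.\<close>
  have "3 ^ top_exp J u * u \<le> 3 * J" if "u \<le> 3 * J"
    using low[of "top_exp J u - 1"] that by (cases "top_exp J u") auto
  moreover have "3 ^ a * u \<le> 3 ^ top_exp J u * u" if "a \<le> top_exp J u"
    using that by (simp add: power_increasing)
  ultimately show "3 ^ a * u \<le> 3 * J" if "u \<le> 3 * J" "a \<le> top_exp J u"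
    using that by (meson le_trans)
qed

lemma glaisher_inj:
  assumes "pos_partition xs" "\<forall>x\<in>set xs. x \<le> 3 * J" "\<forall>x\<le>J. count_list xs x \<le> 2"
    and "pos_partition ys" "\<forall>x\<in>set ys. x \<le> 3 * J" "\<forall>x\<le>J. count_list ys x \<le> 2"
    and eq: "mset (concat (map split3 xs)) = mset (concat (map split3 ys))"
  shows "xs = ys"
proof (rule partition_mset_eqI)
  show "partition xs" "partition ys" using assms by (auto simp: pos_partition_def)
  show "mset xs = mset ys"
  proof (rule multiset_eqI)
    fix t
    show "count (mset xs) t = count (mset ys) t"
    proof (cases "0 < t \<and> t \<le> 3 * J")
      case True
      then obtain a u where t: "t = 3 ^ a * u" "\<not> 3 dvd u" using obtain_multiplicity3 by blast
      then have "0 < u" by (cases u) auto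
      note top = top_exp[OF this, of _ J]
      have cnt: "count_list (concat (map split3 zs)) u = (\<Sum>a\<le>top_exp J u. 3 ^ a * count_list zs (3 ^ a * u))"
        if "pos_partition zs" "\<forall>x\<in>set zs. x \<le> 3 * J" for zs
        using that top(2) t(2) by (intro count_concat_split3) (auto simp: pos_partition_def)
      have "(\<Sum>a\<le>top_exp J u. 3 ^ a * count_list xs (3 ^ a * u)) = (\<Sum>a\<le>top_exp J u. 3 ^ a * count_list ys (3 ^ a * u))"
        using cnt[OF assms(1,2)] cnt[OF assms(4,5)] eq by (metis count_mset)
      then have "count_list xs (3 ^ a * u) = count_list ys (3 ^ a * u)"
        by (rule ternary_unique) (use assms(3,6) top True t in auto)
      then show ?thesis by (simp add: count_mset t)
    next
      case False
      then have "t \<notin> set xs" "t \<notin> set ys" using assms by (auto simp: pos_partition_def)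
      then show ?thesis by (simp add: count_mset)
    qed
  qed
qed

text \<open>The multiplicity of each \<open>u\<close> in \<open>M\<close> is written in ternary with
  top position \<open>top_exp J u\<close>, and the digits become the multiplicities of the parts
  \<open>3 ^ a * u\<close>.\<close>

lemma glaisher_surj:
  assumes "\<forall>u\<in>#M. \<not> 3 dvd u \<and> u \<le> 3 * J"
  shows "\<exists>xs. pos_partition xs \<and> (\<forall>x\<in>set xs. x \<le> 3 * J) \<and> (\<forall>x\<le>J. count_list xs x \<le> 2) \<and>
    mset (concat (map split3 xs)) = M"
proof -
  have "\<exists>f. (\<Sum>a\<le>top_exp J u. 3 ^ a * f a) = count M u \<and> (\<forall>a<top_exp J u. f a \<le> 2)" for u
    by (rule ternary_exists)
  then obtain f where f: "\<And>u. (\<Sum>a\<le>top_exp J u. 3 ^ a * f u a) = count M u"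
    "\<And>u a. a < top_exp J u \<Longrightarrow> f u a \<le> 2" by metis
  define d where "d t = f (t div 3 ^ multiplicity 3 t) (multiplicity 3 t)" for t :: nat
  have d: "d (3 ^ a * u) = f u a" if "\<not> 3 dvd u" for a u
    using that by (simp add: d_def multiplicity3_power_mult)
  define M' where "M' = (\<Sum>t\<in>{1..3 * J}. replicate_mset (d t) t)"
  have cM': "count M' t = (if t \<in> {1..3 * J} then d t else 0)" for t
    by (simp add: M'_def count_sum)
  define xs where "xs = sort_desc (SOME ys. mset ys = M')"
  have mset: "mset xs = M'"
    unfolding xs_def mset_sort_desc by (rule someI_ex) (rule ex_mset)
  have cnt: "count_list xs t = (if t \<in> {1..3 * J} then d t else 0)" for t
    by (metis cM' count_mset mset)
  then have set: "t \<in> {1..3 * J}" if "t \<in> set xs" for t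
    using that by (metis count_list_0_iff)
  have pos: "pos_partition xs" using set by (fastforce simp: pos_partition_def xs_def)
  moreover have "\<forall>x\<in>set xs. x \<le> 3 * J" using set by simp
  moreover have "\<forall>x\<le>J. count_list xs x \<le> 2"
  proof (intro allI impI)
    fix x assume x: "x \<le> J"
    show "count_list xs x \<le> 2"
    proof (cases "x = 0")
      case False
      then obtain a u where t: "x = 3 ^ a * u" "\<not> 3 dvd u" using obtain_multiplicity3 by blast
      then have "0 < u" by (cases u) auto
      then have "a < top_exp J u" using x t by (intro top_exp(4)) auto
      then show ?thesis using f(2) by (simp add: cnt t d)
    qed (simp add: cnt)
  qed
  moreover have "mset (concat (map split3 xs)) = M"
  proof (rule multiset_eqI)
    fix u
    show "count (mset (concat (map split3 xs))) u = count M u"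
    proof (cases "\<not> 3 dvd u \<and> u \<le> 3 * J")
      case True
      then have u: "\<not> 3 dvd u" "u \<le> 3 * J" "0 < u" by (auto intro: Nat.gr0I)
      have "count_list (concat (map split3 xs)) u = (\<Sum>a\<le>top_exp J u. 3 ^ a * count_list xs (3 ^ a * u))"
        using set u top_exp(2)[OF u(3)] by (intro count_concat_split3) force+
      also have "\<dots> = (\<Sum>a\<le>top_exp J u. 3 ^ a * f u a)"
        using u top_exp(3)[OF u(3,2)] by (intro sum.cong) (auto simp: cnt d Suc_le_eq)
      finally show ?thesis by (simp add: count_mset f)
    next
      case False
      then have "u \<notin># M" using assms by blast
      moreover have "u \<notin> set (concat (map split3 xs))"
      proof
        assume "u \<in> set (concat (map split3 xs))"
        then obtain t where "t \<in> set xs" "u \<in> set (split3 t)" by auto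
        then show False using set[of t] split3_elems[of t u] False by auto
      qed
      ultimately show ?thesis by (simp add: count_mset not_in_iff)
    qed
  qed
  ultimately show ?thesis by blast
qed

section \<open>\<open>Gamma3\<close> as Glaisher's bijection with a marked largest part\<close>

lemma hd_sort_desc_Cons: "\<forall>x\<in>set xs. x \<le> m \<Longrightarrow> hd (sort_desc (m # xs)) = m"
proof -
  assume "\<forall>x\<in>set xs. x \<le> m"
  then have "sort_desc (m # xs) = m # sort_desc xs"
    by (intro partition_mset_eqI) auto
  then show ?thesis by simp
qed

lemma sum_list_concat_split3: "\<forall>t\<in>set xs. 0 < t \<Longrightarrow> sum_list (concat (map split3 xs)) = sum_list xs"
  by (induction xs) (auto simp: sum_list_split3)

lemma C3_cases:
  assumes "xs \<in> C3 n"
  obtains J zs where "xs = 3 * J # zs" "0 < J" "pos_partition zs" "\<forall>x\<in>set zs. x \<le> 3 * J"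
    "\<forall>x\<le>J. count_list zs x \<le> 2" "sum_list zs + 3 * J = n"
proof -
  obtain J where J: "hd xs = 3 * J" "\<forall>x\<in>set xs. x \<le> J \<longrightarrow> count_list xs x \<le> 2"
    and xs: "pos_partition xs" "sum_list xs = n" "xs \<noteq> []"
    using assms by (auto simp: C3_def)
  define zs where "zs = tl xs"
  have eq: "xs = 3 * J # zs" using J(1) xs(3) by (metis zs_def list.collapse)
  have "0 < J" using xs(1) by (simp add: eq pos_partition_def)
  moreover have "count_list zs x \<le> 2" if "x \<le> J" for x
  proof (cases "x \<in> set zs")
    case True
    then have "count_list xs x \<le> 2" using J(2) that by (simp add: eq)
    then show ?thesis by (simp add: eq split: if_splits)
  qed simp
  ultimately show ?thesis using that[of J zs] xs(1,2) eq by (auto simp: pos_partition_def)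
qed

text \<open>Pieces of parts up to \<open>3 * J\<close> are prime to 3, so they are at most
  \<open>3 * J - 1\<close>. Hence the image has largest part \<open>3 * J - 1\<close>, which returns
  \<open>J\<close>, and the rest is Glaisher's bijection.\<close>

lemma bij_betw_Gamma3: "bij_betw Gamma3 (C3 (Suc N)) (B3_res2 N)"
  unfolding bij_betw_def
proof
  have G: "mset (Gamma3 (3 * J # zs)) = add_mset (3 * J - 1) (mset (concat (map split3 zs)))"
    "hd (Gamma3 (3 * J # zs)) = 3 * J - 1"
    "\<forall>x\<in>set (Gamma3 (3 * J # zs)). \<not> 3 dvd x \<and> 0 < x"
    if J: "0 < J" and zs: "pos_partition zs" "\<forall>x\<in>set zs. x \<le> 3 * J" for J zs
  proof -
    have J3: "\<not> 3 dvd 3 * J - 1"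
    proof -
      obtain j where "J = Suc j" using J by (cases J) auto
      then have "3 * J - 1 = 3 * j + 2" by simp
      moreover have "\<not> 3 dvd 3 * j + 2" by presburger
      ultimately show ?thesis by simp
    qed
    have el: "\<not> 3 dvd x \<and> x \<le> 3 * J - 1" if "x \<in> set (concat (map split3 zs))" for x
    proof -
      obtain t where t: "t \<in> set zs" "x \<in> set (split3 t)" using \<open>x \<in> _\<close> by auto
      then have "\<not> 3 dvd x" "x \<le> 3 * J" using zs split3_elems[of t x] by (auto simp: pos_partition_def)
      then show ?thesis by (cases "x = 3 * J") auto
    qed
    show "mset (Gamma3 (3 * J # zs)) = add_mset (3 * J - 1) (mset (concat (map split3 zs)))"
      by (simp add: Gamma3_def)
    show "hd (Gamma3 (3 * J # zs)) = 3 * J - 1"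
      unfolding Gamma3_def list.sel by (rule hd_sort_desc_Cons) (use el in blast)
    show "\<forall>x\<in>set (Gamma3 (3 * J # zs)). \<not> 3 dvd x \<and> 0 < x"
    proof
      fix x assume "x \<in> set (Gamma3 (3 * J # zs))"
      then have "x = 3 * J - 1 \<or> x \<in> set (concat (map split3 zs))"
        unfolding Gamma3_def list.sel set_sort_desc list.set by blast
      then have "\<not> 3 dvd x" using J3 el by blast
      then show "\<not> 3 dvd x \<and> 0 < x" by (auto intro: Nat.gr0I)
    qed
  qed
  show "inj_on Gamma3 (C3 (Suc N))"
  proof (rule inj_onI)
    fix xs ys assume *: "xs \<in> C3 (Suc N)" "ys \<in> C3 (Suc N)" "Gamma3 xs = Gamma3 ys"
    obtain J zs where xs: "xs = 3 * J # zs" "0 < J" "pos_partition zs" "\<forall>x\<in>set zs. x \<le> 3 * J"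
      "\<forall>x\<le>J. count_list zs x \<le> 2" using C3_cases[OF *(1)] .
    obtain K ws where ys: "ys = 3 * K # ws" "0 < K" "pos_partition ws" "\<forall>x\<in>set ws. x \<le> 3 * K"
      "\<forall>x\<le>K. count_list ws x \<le> 2" using C3_cases[OF *(2)] .
    have "3 * J - 1 = 3 * K - 1"
      using G(2)[OF xs(2-4)] G(2)[OF ys(2-4)] *(3) unfolding xs(1) ys(1) by simp
    then have J: "J = K" using xs(2) ys(2) by simp
    have "mset (concat (map split3 zs)) = mset (concat (map split3 ws))"
      using G(1)[OF xs(2-4)] G(1)[OF ys(2-4)] *(3) unfolding xs(1) ys(1) J by simp
    then have "zs = ws"
      by (rule glaisher_inj[OF xs(3-5) ys(3-5)[folded J]])
    then show "xs = ys" using xs(1) ys(1) J by simp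
  qed
  show "Gamma3 ` C3 (Suc N) = B3_res2 N"
  proof (intro equalityI subsetI)
    fix ys assume "ys \<in> Gamma3 ` C3 (Suc N)"
    then obtain xs where *: "xs \<in> C3 (Suc N)" "ys = Gamma3 xs" by blast
    obtain J zs where xs: "xs = 3 * J # zs" "0 < J" "pos_partition zs" "\<forall>x\<in>set zs. x \<le> 3 * J"
      "\<forall>x\<le>J. count_list zs x \<le> 2" "sum_list zs + 3 * J = Suc N" using C3_cases[OF *(1)] .
    obtain j where j: "J = Suc j" using xs(2) by (cases J) auto
    have "sum_list ys = 3 * J - 1 + sum_list (concat (map split3 zs))"
      unfolding *(2) xs(1) Gamma3_def list.sel sum_list_sort_desc by simp
    then have "sum_list ys = N"
      using xs(2,3,6) sum_list_concat_split3[of zs] by (simp add: pos_partition_def)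
    moreover have "ys \<noteq> []" unfolding *(2) xs(1) using G(1)[OF xs(2-4)] by auto
    moreover have "(3 * J - 1) mod 3 = 2"
    proof -
      have "3 * J - 1 = 3 * j + 2" by (simp add: j)
      moreover have "(3 * j + 2) mod 3 = 2" by presburger
      ultimately show ?thesis by simp
    qed
    moreover have "partition ys" unfolding *(2) Gamma3_def by simp
    ultimately show "ys \<in> B3_res2 N"
      using G(2,3)[OF xs(2-4)] by (simp add: B3_res2_def B3_def pos_partition_def *(2) xs(1))
  next
    fix ys assume "ys \<in> B3_res2 N"
    then have ys: "pos_partition ys" "sum_list ys = N" "\<forall>x\<in>set ys. \<not> 3 dvd x" "ys \<noteq> []" "hd ys mod 3 = 2"
      by (auto simp: B3_res2_def B3_def)
    define b where "b = hd ys"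
    define J where "J = Suc (b div 3)"
    have b: "b = 3 * J - 1"
    proof -
      have "b = 3 * (b div 3) + 2" using ys(5) by (metis b_def mult_div_mod_eq)
      then show ?thesis by (simp add: J_def)
    qed
    have "\<forall>u\<in>#mset (tl ys). \<not> 3 dvd u \<and> u \<le> 3 * J"
    proof
      fix u assume "u \<in># mset (tl ys)"
      then have "u \<in> set ys" using ys(4) by (simp add: list.set_sel(2))
      then show "\<not> 3 dvd u \<and> u \<le> 3 * J"
        using ys(1,3) partition_le_hd[of ys u] b by (auto simp: pos_partition_def b_def)
    qed
    from glaisher_surj[OF this] obtain zs where zs: "pos_partition zs" "\<forall>x\<in>set zs. x \<le> 3 * J"
      "\<forall>x\<le>J. count_list zs x \<le> 2" "mset (concat (map split3 zs)) = mset (tl ys)" by blast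
    have J0: "0 < J" by (simp add: J_def)
    have "mset (Gamma3 (3 * J # zs)) = add_mset b (mset (tl ys))"
      using G(1)[OF J0 zs(1,2)] zs(4) b by simp
    also have "\<dots> = mset ys" using ys(4) by (cases ys) (simp_all add: b_def)
    finally have "Gamma3 (3 * J # zs) = ys"
      using ys(1) by (intro partition_mset_eqI) (simp_all add: Gamma3_def pos_partition_def)
    moreover have "3 * J # zs \<in> C3 (Suc N)"
    proof -
      have "sum_list (concat (map split3 zs)) = sum_list (tl ys)"
        using zs(4) by (metis sum_mset_sum_list)
      then have "sum_list zs = sum_list (tl ys)"
        using sum_list_concat_split3[of zs] zs(1) by (simp add: pos_partition_def)
      moreover have "b + sum_list (tl ys) = N" using ys(2,4) by (cases ys) (simp_all add: b_def)
      ultimately have "sum_list (3 * J # zs) = Suc N" using b J0 by simp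
      \<comment> \<open>The extra copy of \<open>3 * J\<close> is not counted, since
        \<open>3 * J\<close> exceeds \<open>J\<close>.\<close>
      moreover have "count_list (3 * J # zs) x \<le> 2" if "x \<le> J" for x
        using zs(3) that J0 by simp
      ultimately show ?thesis using zs(1,2) J0 by (simp add: C3_def pos_partition_def)
    qed
    ultimately show "ys \<in> Gamma3 ` C3 (Suc N)" by blast
  qed
qed

section \<open>The map \<open>T_map\<close>\<close>

lemma partition_split_min:
  assumes "partition xs" "\<forall>x\<in>set xs. l \<le> x"
  shows "xs = filter (\<lambda>x. l < x) xs @ replicate (count_list xs l) l"
  using assms
proof (induction xs)
  case (Cons x xs)
  show ?case
  proof (cases "x = l")
    case True
    then have "\<forall>y\<in>set xs. y = l" using Cons.prems by (auto intro: le_antisym)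
    then have "xs = replicate (length xs) l" "filter (\<lambda>x. l < x) xs = []"
      by (auto intro: replicate_eqI simp: filter_empty_conv)
    moreover have "count_list xs l = length xs"
      using \<open>\<forall>y\<in>set xs. y = l\<close> by (induction xs) auto
    ultimately show ?thesis using True by simp
  qed (use Cons in auto)
qed simp

lemma partition_split_last:
  "partition xs \<Longrightarrow> xs = filter (\<lambda>x. last xs < x) xs @ replicate (count_list xs (last xs)) (last xs)"
  by (rule partition_split_min) (use partition_last_le in auto)

lemma length_eq_tau:
  assumes "partition xs"
  shows "length xs = tau xs + count_list xs (last xs)"
  using arg_cong[OF partition_split_last[OF assms], of length] by (simp add: tau_def)

text \<open>The lists \<eta> between the two steps of \<open>T_map\<close>. The smallest part may
  occur three times because the adjoined or raised part can join two equal ones.\<close>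

definition E3 :: "nat \<Rightarrow> nat list set" where
  "E3 N = {xs. pos_partition xs \<and> sum_list xs = N \<and> xs \<noteq> [] \<and> length xs mod 3 = 0 \<and>
     count_list xs (last xs) \<le> 3 \<and> (\<forall>x. x \<noteq> last xs \<longrightarrow> count_list xs x \<le> 2)}"

lemma pos_partition_snoc:
  "pos_partition (xs @ [x]) \<longleftrightarrow> pos_partition xs \<and> 0 < x \<and> (\<forall>y\<in>set xs. x \<le> y)"
  by (auto simp: pos_partition_def partition_append)

lemma R3_length_0_cases:
  assumes "xs \<in> R3 N" "length xs mod 3 \<noteq> 2"
  obtains zs s where "xs = zs @ [s]" "0 < s" "\<forall>y\<in>set zs. s < y" "Suc (length zs) mod 3 = 0"
proof -
  have xs: "xs \<noteq> []" "length xs mod 3 = 0" "count_list xs (last xs) = 1" "pos_partition xs"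
    using assms by (auto simp: R3_def)
  then obtain zs s where zs: "xs = zs @ [s]" by (metis append_butlast_last_id)
  then have "count_list zs s = 0" using xs by simp
  then have "s \<notin> set zs" by (simp add: count_list_0_iff)
  then have "\<forall>y\<in>set zs. s < y"
    using xs(4) unfolding zs pos_partition_snoc by (metis le_neq_implies_less)
  with that zs xs show ?thesis by (simp add: pos_partition_snoc)
qed

lemma mod3_Suc_iff: "Suc n mod 3 = 0 \<longleftrightarrow> n mod 3 = 2"
  by (auto simp: mod_Suc)

text \<open>A smallest part 1 marks the branch that adjoins a part, because a raised part is at
  least 2.\<close>

lemma bij_betw_T_raise: "bij_betw T_raise (R3 N) (E3 (Suc N))"
proof (rule bij_betw_byWitness[where f' = "\<lambda>ys. if last ys = 1 then butlast ys else butlast ys @ [last ys - 1]"])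
  have R: "T_raise xs \<in> E3 (Suc N) \<and>
      (if last (T_raise xs) = 1 then butlast (T_raise xs) else butlast (T_raise xs) @ [last (T_raise xs) - 1]) = xs"
    if xs: "xs \<in> R3 N" for xs
  proof (cases "length xs mod 3 = 2")
    case True
    have "count_list xs x \<le> 2" for x using xs by (simp add: R3_def)
    then have "count_list xs 1 < 3" by (simp add: le_imp_less_Suc numeral_3_eq_3 numeral_2_eq_2)
    then show ?thesis
      using xs True by (auto simp: T_raise_def E3_def R3_def pos_partition_snoc mod3_Suc_iff)
        (auto simp: pos_partition_def Suc_le_eq)
  next
    case False
    then obtain zs s where zs: "xs = zs @ [s]" "0 < s" "\<forall>y\<in>set zs. s < y" "Suc (length zs) mod 3 = 0"
      using xs R3_length_0_cases by blast
    have c: "count_list xs x \<le> 2" "sum_list xs = N" "pos_partition xs" for x using xs by (auto simp: R3_def)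
    have c': "count_list zs x \<le> 2" for x
      using c(1)[of x] by (simp add: zs split: if_splits)
    then have "count_list zs (Suc s) < 3" by (simp add: le_imp_less_Suc numeral_3_eq_3 numeral_2_eq_2)
    with c' show ?thesis
      using False zs c by (auto simp: T_raise_def E3_def pos_partition_snoc Suc_le_eq)
  qed
  then show "T_raise ` R3 N \<subseteq> E3 (Suc N)"
    "\<forall>xs\<in>R3 N. (if last (T_raise xs) = 1 then butlast (T_raise xs) else butlast (T_raise xs) @ [last (T_raise xs) - 1]) = xs"
    by blast+
  have E: "(if last ys = 1 then butlast ys else butlast ys @ [last ys - 1]) \<in> R3 N \<and>
      T_raise (if last ys = 1 then butlast ys else butlast ys @ [last ys - 1]) = ys" if ys: "ys \<in> E3 (Suc N)" for ys
  proof -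
    have "ys \<noteq> []" using ys by (simp add: E3_def)
    then obtain zs b where zs: "ys = zs @ [b]" by (cases ys rule: rev_cases) auto
    have l: "Suc (length zs) mod 3 = 0" "pos_partition zs" "0 < b" "\<forall>y\<in>set zs. b \<le> y" "sum_list zs + b = Suc N"
      and c: "count_list zs b \<le> 2" "\<And>x. x \<noteq> b \<Longrightarrow> count_list zs x \<le> 2"
      using ys by (auto simp: E3_def zs pos_partition_snoc split: if_splits)
    have c': "count_list zs x \<le> 2" for x using c by (cases "x = b") auto
    show ?thesis
    proof (cases "b = 1")
      case True
      then show ?thesis using l c' by (auto simp: zs R3_def T_raise_def mod3_Suc_iff)
    next
      case False
      \<comment> \<open>Lowered by one, the last part lies strictly below all others, so it occurs
        once, as \<open>R3\<close> demands.\<close>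
      have "b - 1 \<notin> set zs" using l(3,4) by fastforce
      then have "count_list zs (b - 1) = 0" by (simp add: count_list_0_iff)
      moreover have "\<forall>y\<in>set zs. b - 1 \<le> y" using l by fastforce
      ultimately show ?thesis using False l c' by (auto simp: zs R3_def T_raise_def pos_partition_snoc)
    qed
  qed
  then show "(\<lambda>ys. if last ys = 1 then butlast ys else butlast ys @ [last ys - 1]) ` E3 (Suc N) \<subseteq> R3 N"
    "\<forall>ys\<in>E3 (Suc N). T_raise (if last ys = 1 then butlast ys else butlast ys @ [last ys - 1]) = ys"
    by blast+
qed

text \<open>If the smallest part occurs three times, \<open>tau\<close> is the length minus 3;
  otherwise the three zeros become the smallest part and \<open>tau\<close> is the old length. Both
  are 0 modulo 3, and deleting zeros inverts either case.\<close>

lemma bij_betw_append_zeros: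
  assumes "0 < N"
  shows "bij_betw (\<lambda>ys. if count_list ys (last ys) = 3 then ys else ys @ [0, 0, 0]) (E3 N) (D3_class 0 N)"
proof (rule bij_betw_byWitness[where f' = "filter (\<lambda>x. 0 < x)"])
  let ?Z = "\<lambda>ys::nat list. if count_list ys (last ys) = 3 then ys else ys @ [0, 0, 0]"
  have E: "?Z ys \<in> D3_class 0 N \<and> filter (\<lambda>x. 0 < x) (?Z ys) = ys" if ys: "ys \<in> E3 N" for ys
  proof -
    have p: "partition ys" "\<forall>x\<in>set ys. 0 < x" "sum_list ys = N" "ys \<noteq> []" "length ys mod 3 = 0"
      and c: "count_list ys (last ys) \<le> 3" "\<And>x. x \<noteq> last ys \<Longrightarrow> count_list ys x \<le> 2"
      using ys by (auto simp: E3_def pos_partition_def)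
    have f: "filter (\<lambda>x. 0 < x) ys = ys" using p(2) by simp
    show ?thesis
    proof (cases "count_list ys (last ys) = 3")
      case True
      then have "tau ys mod 3 = 0" using length_eq_tau[OF p(1)] p(5) by simp
      then show ?thesis using True p c f by (auto simp: D3_class_def D3_def)
    next
      case False
      have "count_list ys x \<le> 2" for x using c False by (cases "x = last ys") auto
      moreover have "count_list ys 0 = 0" using p(2) by (auto simp: count_list_0_iff)
      ultimately show ?thesis
        using False p f by (auto simp: D3_class_def D3_def partition_append tau_def)
    qed
  qed
  then show "?Z ` E3 N \<subseteq> D3_class 0 N" "\<forall>ys\<in>E3 N. filter (\<lambda>x. 0 < x) (?Z ys) = ys" by blast+
  have D: "filter (\<lambda>x. 0 < x) xs \<in> E3 N \<and> ?Z (filter (\<lambda>x. 0 < x) xs) = xs" if xs: "xs \<in> D3_class 0 N" for xs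
  proof -
    have p: "partition xs" "sum_list xs = N" "xs \<noteq> []" "count_list xs (last xs) = 3" "tau xs mod 3 = 0"
      and c: "\<And>x. x \<in> set xs \<Longrightarrow> last xs < x \<Longrightarrow> count_list xs x \<le> 2"
      using xs by (auto simp: D3_class_def D3_def)
    have c': "count_list xs x \<le> 2" if "x \<noteq> last xs" for x
    proof (cases "x \<in> set xs")
      case True
      then show ?thesis using c partition_last_le[OF p(1)] that by (metis le_neq_implies_less)
    qed (simp add: count_list_0_iff[THEN iffD2])
    show ?thesis
    proof (cases "last xs = 0")
      case False
      then have "\<forall>x\<in>set xs. 0 < x" using partition_last_le[OF p(1)] by fastforce
      moreover from this have "filter (\<lambda>x. 0 < x) xs = xs" by simp
      ultimately show ?thesis
        using p c' length_eq_tau[OF p(1)] by (auto simp: E3_def pos_partition_def)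
    next
      case True
      define ys where "ys = filter (\<lambda>x. 0 < x) xs"
      have eq: "xs = ys @ [0, 0, 0]"
        using partition_split_last[OF p(1)] p(4) unfolding True ys_def[symmetric] by (simp add: numeral_3_eq_3)
      have pos: "\<forall>x\<in>set ys. 0 < x" by (simp add: ys_def)
      \<comment> \<open>Here \<open>0 < N\<close> excludes \<open>[0, 0, 0]\<close>, which has no
        positive part.\<close>
      have ne: "ys \<noteq> []" using assms p(2) by (auto simp: eq)
      have "count_list ys x \<le> 2" for x
      proof (cases "x = 0")
        case True
        then have "x \<notin> set ys" using pos by auto
        then show ?thesis by (simp add: count_list_0_iff[THEN iffD2])
      next
        case False
        then show ?thesis using c'[of x] by (simp add: eq)
      qed
      moreover from this[of "last ys"] have "count_list ys (last ys) \<le> 3" "count_list ys (last ys) \<noteq> 3" by simp_all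
      moreover have "length ys mod 3 = 0" using p(4,5) length_eq_tau[OF p(1)] by (simp add: eq)
      moreover have "partition ys" "sum_list ys = N" using p(1,2) by (simp_all add: eq partition_append)
      ultimately show ?thesis
        using pos ne unfolding ys_def[symmetric] by (auto simp: E3_def pos_partition_def eq[symmetric] intro: le_SucI)
    qed
  qed
  then show "filter (\<lambda>x. 0 < x) ` D3_class 0 N \<subseteq> E3 N"
    "\<forall>xs\<in>D3_class 0 N. ?Z (filter (\<lambda>x. 0 < x) xs) = xs" by blast+
qed

lemma bij_betw_T_map: "bij_betw T_map (R3 N) (D3_class 0 (Suc N))"
proof -
  have "T_map = (\<lambda>ys. if count_list ys (last ys) = 3 then ys else ys @ [0, 0, 0]) \<circ> T_raise"
    by (simp add: fun_eq_iff T_map_def Let_def)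
  then show ?thesis
    using bij_betw_trans[OF bij_betw_T_raise bij_betw_append_zeros] by simp
qed

section \<open>Equidistribution of \<open>tau\<close> modulo 3\<close>

definition parts_upto :: "nat \<Rightarrow> nat \<Rightarrow> nat list set" where
  "parts_upto M m = {xs. partition xs \<and> set xs \<subseteq> {m<..M} \<and> (\<forall>x. count_list xs x \<le> 2)}"

lemma count_list_filter: "count_list (filter P xs) x = (if P x then count_list xs x else 0)"
  by (induction xs) auto

text \<open>Splitting off the copies of the smallest admissible part, none to two of them, gives one
  factor of the product in \<open>sum_parts_upto\<close>.\<close>

lemma bij_betw_parts_upto:
  assumes "m < M"
  shows "bij_betw (\<lambda>(xs, k). xs @ replicate k (Suc m)) (parts_upto M (Suc m) \<times> {..2}) (parts_upto M m)"
proof (rule bij_betw_byWitness[where f' = "\<lambda>xs. (filter (\<lambda>x. Suc m < x) xs, count_list xs (Suc m))"])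
  have fwd: "xs @ replicate k (Suc m) \<in> parts_upto M m \<and>
      filter (\<lambda>x. Suc m < x) (xs @ replicate k (Suc m)) = xs \<and> count_list (xs @ replicate k (Suc m)) (Suc m) = k"
    if xs: "xs \<in> parts_upto M (Suc m)" and k: "k \<le> 2" for xs k
  proof -
    have p: "partition xs" "set xs \<subseteq> {Suc m<..M}" "\<And>x. count_list xs x \<le> 2"
      using xs by (auto simp: parts_upto_def)
    have "Suc m \<notin> set xs" using p(2) by auto
    then have c: "count_list xs (Suc m) = 0" by (simp add: count_list_0_iff)
    have "partition (replicate k (Suc m))" by (induction k) auto
    then have "partition (xs @ replicate k (Suc m))"
      using p(1,2) by (auto simp: partition_append)
    moreover have "count_list (xs @ replicate k (Suc m)) x \<le> 2" for x
      using p(3)[of x] k c by (simp add: count_list_replicate)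
    moreover have "set (xs @ replicate k (Suc m)) \<subseteq> {m<..M}" using p(2) assms by auto
    moreover have "filter (\<lambda>x. Suc m < x) xs = xs" using p(2) by (auto simp: filter_id_conv)
    ultimately show ?thesis using c by (simp add: parts_upto_def count_list_replicate)
  qed
  then show "(\<lambda>(xs, k). xs @ replicate k (Suc m)) ` (parts_upto M (Suc m) \<times> {..2}) \<subseteq> parts_upto M m"
    "\<forall>z\<in>parts_upto M (Suc m) \<times> {..2}. (\<lambda>xs. (filter (\<lambda>x. Suc m < x) xs, count_list xs (Suc m)))
      ((\<lambda>(xs, k). xs @ replicate k (Suc m)) z) = z"
    by auto
  have bwd: "filter (\<lambda>x. Suc m < x) xs \<in> parts_upto M (Suc m) \<and> count_list xs (Suc m) \<le> 2 \<and>
      filter (\<lambda>x. Suc m < x) xs @ replicate (count_list xs (Suc m)) (Suc m) = xs"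
    if xs: "xs \<in> parts_upto M m" for xs
  proof -
    have p: "partition xs" "set xs \<subseteq> {m<..M}" "\<And>x. count_list xs x \<le> 2"
      using xs by (auto simp: parts_upto_def)
    have "\<forall>x\<in>set xs. Suc m \<le> x" using p(2) by auto
    note split = partition_split_min[OF p(1) this]
    have "partition (filter (\<lambda>x. Suc m < x) xs)"
      using p(1) by (simp add: partition_def sorted_wrt_filter)
    then show ?thesis
      using p(2,3) split[symmetric] by (auto simp: parts_upto_def count_list_filter)
  qed
  then show "(\<lambda>xs. (filter (\<lambda>x. Suc m < x) xs, count_list xs (Suc m))) ` parts_upto M m \<subseteq> parts_upto M (Suc m) \<times> {..2}"
    "\<forall>xs\<in>parts_upto M m. (\<lambda>(xs, k). xs @ replicate k (Suc m)) (filter (\<lambda>x. Suc m < x) xs, count_list xs (Suc m)) = xs"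
    by auto
qed

lemma parts_upto_self: "parts_upto M M = {[]}"
  by (auto simp: parts_upto_def)

lemma sum_parts_upto:
  fixes z q :: "'a::comm_ring_1"
  assumes "m \<le> M"
  shows "finite (parts_upto M m) \<and> (\<Sum>xs\<in>parts_upto M m. z ^ length xs * q ^ sum_list xs) =
    (\<Prod>j\<in>{m<..M}. 1 + z * q ^ j + z\<^sup>2 * q ^ (2 * j))"
  using assms
proof (induction m rule: inc_induct)
  case (step m)
  note bij = bij_betw_parts_upto[OF step(2)]
  have fin: "finite (parts_upto M m)"
    using bij_betw_finite[OF bij] step.IH by simp
  have "(\<Sum>xs\<in>parts_upto M m. z ^ length xs * q ^ sum_list xs) =
      (\<Sum>(xs, k)\<in>parts_upto M (Suc m) \<times> {..2}.
        (z ^ length xs * q ^ sum_list xs) * (z ^ k * q ^ (k * Suc m)))"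
    by (subst sum.reindex_bij_betw[OF bij, symmetric])
      (auto intro!: sum.cong simp: sum_list_replicate power_add algebra_simps)
  also have "\<dots> = (\<Sum>xs\<in>parts_upto M (Suc m). z ^ length xs * q ^ sum_list xs) *
      (\<Sum>k\<in>{..2}. z ^ k * q ^ (k * Suc m))"
    by (simp only: sum_product sum.cartesian_product)
  also have "(\<Sum>k\<in>{..2}. z ^ k * q ^ (k * Suc m)) = 1 + z * q ^ Suc m + z\<^sup>2 * q ^ (2 * Suc m)"
    by (simp add: numeral_2_eq_2)
  also have "(\<Sum>xs\<in>parts_upto M (Suc m). z ^ length xs * q ^ sum_list xs) =
      (\<Prod>j\<in>{Suc m<..M}. 1 + z * q ^ j + z\<^sup>2 * q ^ (2 * j))"
    using step.IH by blast
  also have "\<dots> * (1 + z * q ^ Suc m + z\<^sup>2 * q ^ (2 * Suc m)) =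
      (\<Prod>j\<in>{m<..M}. 1 + z * q ^ j + z\<^sup>2 * q ^ (2 * j))"
  proof -
    have "{m<..M} = insert (Suc m) {Suc m<..M}" using step(2) by auto
    then show ?thesis by (simp add: mult.commute)
  qed
  finally show ?case using fin by blast
qed (simp add: parts_upto_self)

lemma finite_parts_upto: "m \<le> M \<Longrightarrow> finite (parts_upto M m)"
  using sum_parts_upto[of m M "1 :: int" 1] by blast

text \<open>Cutting the parts at \<open>n\<close> loses nothing, since no part exceeds the weight,
  and keeps the index set finite.\<close>

lemma bij_betw_D3:
  "bij_betw (\<lambda>(m, xs). xs @ [m, m, m]) (SIGMA m:{..n}. {xs \<in> parts_upto n m. 3 * m + sum_list xs = n}) (D3 n)"
proof (rule bij_betw_byWitness[where f' = "\<lambda>xs. (last xs, filter (\<lambda>x. last xs < x) xs)"])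
  let ?S = "SIGMA m:{..n}. {xs \<in> parts_upto n m. 3 * m + sum_list xs = n}"
  have fwd: "xs @ [m, m, m] \<in> D3 n \<and> filter (\<lambda>x. m < x) (xs @ [m, m, m]) = xs"
    if "xs \<in> parts_upto n m" "3 * m + sum_list xs = n" for m xs
  proof -
    have p: "partition xs" "set xs \<subseteq> {m<..n}" "\<And>x. count_list xs x \<le> 2"
      using that by (auto simp: parts_upto_def)
    have "m \<notin> set xs" using p(2) by auto
    then have "count_list xs m = 0" by (simp add: count_list_0_iff)
    moreover have "filter (\<lambda>x. m < x) xs = xs" using p(2) by (auto simp: filter_id_conv)
    moreover have "partition (xs @ [m, m, m])" using p by (auto simp: partition_append)
    ultimately show ?thesis using p(3) that(2) by (auto simp: D3_def)
  qed
  then show "(\<lambda>(m, xs). xs @ [m, m, m]) ` ?S \<subseteq> D3 n"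
    "\<forall>z\<in>?S. (\<lambda>xs. (last xs, filter (\<lambda>x. last xs < x) xs)) ((\<lambda>(m, xs). xs @ [m, m, m]) z) = z"
    by auto
  have bwd: "(last xs, filter (\<lambda>x. last xs < x) xs) \<in> ?S \<and> filter (\<lambda>x. last xs < x) xs @ [last xs, last xs, last xs] = xs"
    if xs: "xs \<in> D3 n" for xs
  proof -
    define m where "m = last xs"
    define ys where "ys = filter (\<lambda>x. m < x) xs"
    have p: "partition xs" "sum_list xs = n" "count_list xs m = 3"
      "\<And>x. x \<in> set xs \<Longrightarrow> m < x \<Longrightarrow> count_list xs x \<le> 2"
      using xs by (auto simp: D3_def m_def)
    have split: "xs = ys @ [m, m, m]"
      using partition_split_last[OF p(1)] p(3) by (simp add: m_def[symmetric] ys_def numeral_3_eq_3)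
    have "partition ys" using p(1) by (simp add: ys_def partition_def sorted_wrt_filter)
    moreover have "set ys \<subseteq> {m<..n}"
      using member_le_sum_list[of _ xs] p(2) by (auto simp: ys_def)
    moreover have "count_list ys x \<le> 2" for x
    proof (cases "x \<in> set ys")
      case True
      then show ?thesis using p(4)[of x] by (simp add: ys_def count_list_filter)
    qed simp
    moreover have "3 * m + sum_list ys = n" using p(2) by (simp add: split)
    ultimately show ?thesis using split unfolding m_def[symmetric] ys_def[symmetric] by (auto simp: parts_upto_def)
  qed
  then show "(\<lambda>xs. (last xs, filter (\<lambda>x. last xs < x) xs)) ` D3 n \<subseteq> ?S"
    "\<forall>xs\<in>D3 n. (\<lambda>(m, xs). xs @ [m, m, m]) (last xs, filter (\<lambda>x. last xs < x) xs) = xs"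
    by auto
qed

lemma finite_D3: "finite (D3 n)"
proof -
  have "finite (SIGMA m:{..n}. {xs \<in> parts_upto n m. 3 * m + sum_list xs = n})"
    by (intro finite_SigmaI) (simp_all add: finite_parts_upto)
  then show ?thesis using bij_betw_finite[OF bij_betw_D3] by blast
qed

text \<open>Three copies of the smallest part \<open>m\<close> give \<open>fps_X ^ (3 * m)\<close>,
  and the parts above it, each marked by \<open>z\<close>, give the product. All sums and products
  are finite, so no convergence enters.\<close>

lemma sum_D3_eq_coeff:
  fixes z :: "'a::comm_ring_1"
  shows "(\<Sum>xs\<in>D3 n. z ^ tau xs) =
    fps_nth (\<Sum>m\<le>n. fps_X ^ (3 * m) *
      (\<Prod>j\<in>{m<..n}. 1 + fps_const z * fps_X ^ j + (fps_const z)\<^sup>2 * fps_X ^ (2 * j))) n"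
proof -
  have tau: "tau (xs @ [m, m, m]) = length xs" if "xs \<in> parts_upto n m" for m xs
  proof -
    have "filter (\<lambda>x. m < x) xs = xs" using that by (auto simp: parts_upto_def filter_id_conv)
    then show ?thesis by (simp add: tau_def)
  qed
  have "(\<Sum>xs\<in>D3 n. z ^ tau xs) =
      (\<Sum>(m, xs)\<in>(SIGMA m:{..n}. {xs \<in> parts_upto n m. 3 * m + sum_list xs = n}). z ^ length xs)"
    by (subst sum.reindex_bij_betw[OF bij_betw_D3, symmetric]) (auto intro!: sum.cong simp: tau)
  also have "\<dots> = (\<Sum>m\<le>n. \<Sum>xs\<in>{xs \<in> parts_upto n m. 3 * m + sum_list xs = n}. z ^ length xs)"
    by (intro sum.Sigma[symmetric]) (simp_all add: finite_parts_upto)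
  also have "\<dots> = (\<Sum>m\<le>n. fps_nth (fps_X ^ (3 * m) *
      (\<Sum>xs\<in>parts_upto n m. fps_const z ^ length xs * fps_X ^ sum_list xs)) n)"
  proof (rule sum.cong[OF refl])
    fix m assume "m \<in> {..n}"
    have "fps_nth (fps_X ^ (3 * m) * (\<Sum>xs\<in>parts_upto n m. fps_const z ^ length xs * fps_X ^ sum_list xs)) n =
        (\<Sum>xs\<in>parts_upto n m. fps_nth (fps_const (z ^ length xs) * fps_X ^ (3 * m + sum_list xs)) n)"
      by (simp only: sum_distrib_left fps_sum_nth fps_const_power power_add mult_ac)
    also have "\<dots> = (\<Sum>xs\<in>parts_upto n m. if 3 * m + sum_list xs = n then z ^ length xs else 0)"
      by (intro sum.cong) (auto simp: fps_X_power_nth)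
    also have "\<dots> = (\<Sum>xs\<in>{xs \<in> parts_upto n m. 3 * m + sum_list xs = n}. z ^ length xs)"
      using \<open>m \<in> {..n}\<close> by (intro sum.inter_filter[symmetric]) (simp add: finite_parts_upto)
    finally show "(\<Sum>xs\<in>{xs \<in> parts_upto n m. 3 * m + sum_list xs = n}. z ^ length xs) =
        fps_nth (fps_X ^ (3 * m) * (\<Sum>xs\<in>parts_upto n m. fps_const z ^ length xs * fps_X ^ sum_list xs)) n" ..
  qed
  also have "\<dots> = fps_nth (\<Sum>m\<le>n. fps_X ^ (3 * m) *
      (\<Prod>j\<in>{m<..n}. 1 + fps_const z * fps_X ^ j + (fps_const z)\<^sup>2 * fps_X ^ (2 * j))) n"
    unfolding fps_sum_nth using sum_parts_upto[of _ n "fps_const z" "fps_X"] by (intro sum.cong) auto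
  finally show ?thesis .
qed

section \<open>Telescoping and the partial theta series\<close>

lemma prod_greaterThan_step:
  fixes f :: "nat \<Rightarrow> 'a::comm_monoid_mult"
  assumes "m < M"
  shows "(\<Prod>j\<in>{m<..M}. f j) = f (Suc m) * (\<Prod>j\<in>{Suc m<..M}. f j)"
proof -
  have "{m<..M} = insert (Suc m) {Suc m<..M}" using assms by auto
  then show ?thesis by simp
qed

text \<open>With \<open>x = q ^ Suc k\<close>, multiplying \<open>P k\<close> by
  \<open>1 - w * x\<close> gives \<open>(1 - x ^ 3) * P (Suc k)\<close>, as
  \<open>w ^ 3 = 1\<close>. So each cubic term is traded for \<open>w * x * P k\<close>, up to a
  difference of consecutive values of \<open>P\<close>.\<close>

lemma sum_cube_power_prod:
  fixes w q :: "'a::comm_ring_1" and M :: nat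
  assumes w: "w ^ 3 = 1"
  defines "P \<equiv> \<lambda>m. \<Prod>j\<in>{m<..M}. 1 + w * q ^ j + w\<^sup>2 * q ^ (2 * j)"
  shows "(\<Sum>m\<le>M. q ^ (3 * m) * P m) = 1 + w * (\<Sum>m<M. q ^ Suc m * P m)"
proof -
  \<comment> \<open>Only the range of summation is cut to \<open>k\<close>, while the products still
    reach \<open>M\<close>; at \<open>k = M\<close> the product is empty.\<close>
  have "(\<Sum>m\<le>k. q ^ (3 * m) * P m) = P k + w * (\<Sum>m<k. q ^ Suc m * P m)" if "k \<le> M" for k
    using that
  proof (induction k)
    case (Suc k)
    define x where "x = q ^ Suc k"
    have P: "P k = (1 + w * x + w\<^sup>2 * x\<^sup>2) * P (Suc k)"
      using Suc.prems unfolding P_def x_def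
      by (subst prod_greaterThan_step) (simp_all only: power_mult[symmetric] mult.commute[of 2] Suc_le_eq)
    have "w * (w * w) = 1" using w by (simp add: power3_eq_cube mult_ac)
    then have cube: "w * (w * (w * y)) = y" for y by (metis mult.assoc mult_1)
    have "q ^ (3 * Suc k) = x ^ 3" by (simp only: x_def power_mult[symmetric] mult.commute)
    then have "P k + q ^ (3 * Suc k) * P (Suc k) = P (Suc k) + w * (x * P k)"
      unfolding P by (simp add: algebra_simps power2_eq_square power3_eq_cube cube)
    then show ?case using Suc by (simp add: algebra_simps x_def)
  qed simp
  from this[of M] show ?thesis by (simp add: P_def)
qed

text \<open>
  \<open>K i\<close> is a truncation of \<open>H (b q\<^sup>i)\<close>, where \<open>H b\<close> is the sum of all
  \<open>q\<^sup>m (1 - q\<^sup>m\<^sup>+\<^sup>1) (1 - b q\<^sup>m\<^sup>+\<^sup>1) (1 - q\<^sup>m\<^sup>+\<^sup>2) (1 - b q\<^sup>m\<^sup>+\<^sup>2) \<dots>\<close>. The functional equation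
  \<open>H b = 1 - b q H (b q)\<close>, which characterises the partial theta function, holds because the two
  sums combine to a telescoping one.
\<close>

lemma telescoping_theta:
  fixes b q :: "'a::comm_ring_1" and M :: nat
  defines "A \<equiv> \<lambda>m. \<Prod>j\<in>{m<..M}. 1 - q ^ j" and "B \<equiv> \<lambda>m. \<Prod>j\<in>{m<..M}. 1 - b * q ^ j"
  defines "K \<equiv> \<lambda>i. \<Sum>m\<le>M. q ^ m * A m * B (m + i)"
  shows "q ^ Suc M dvd K i + b * q ^ Suc i * K (Suc i) - 1"
proof -
  \<comment> \<open>The factor at \<open>j = m\<close> is added to make the sum telescope; at
    \<open>m = 0\<close> it is \<open>1 - q ^ 0\<close>, so \<open>U 0\<close> vanishes.\<close>
  define U where "U m = (\<Prod>j\<in>{m..M}. 1 - q ^ j) * B (m + i)" for m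
  define T where "T m = q ^ m * A m * B (m + i) + b * q ^ Suc i * (q ^ m * A m * B (m + Suc i))" for m
  have AU: "(\<Prod>j\<in>{Suc m..M}. 1 - q ^ j) = A m" for m
    by (simp add: A_def atLeastSucAtMost_greaterThanAtMost)
  have A: "(\<Prod>j\<in>{m..M}. 1 - q ^ j) = (1 - q ^ m) * A m" if "m \<le> M" for m
    using that by (simp add: prod.atLeast_Suc_atMost AU)
  \<comment> \<open>Once \<open>m + i\<close> reaches \<open>M\<close>, the truncated
    \<open>B\<close> no longer follows its recursion, and the discrepancy is a multiple of
    \<open>q ^ Suc M\<close>.\<close>
  have "q ^ Suc M dvd T m - (U (Suc m) - U m)" if "m \<le> M" for m
  proof (cases "m + i < M")
    case True
    have B: "B (m + i) = (1 - b * (q ^ m * q ^ i * q)) * B (m + Suc i)"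
      using True unfolding B_def by (subst prod_greaterThan_step) (simp_all add: power_add mult_ac)
    have "T m = U (Suc m) - U m"
      unfolding T_def U_def AU A[OF that] B by (simp add: algebra_simps)
    then show ?thesis by simp
  next
    case False
    then have "B (m + i) = 1" "B (m + Suc i) = 1" "B (Suc m + i) = 1" by (simp_all add: B_def)
    then have "T m - (U (Suc m) - U m) = b * q ^ (m + Suc i) * A m"
      unfolding T_def U_def AU A[OF that] by (simp add: algebra_simps power_add)
    moreover have "q ^ Suc M dvd q ^ (m + Suc i)" using False by (intro le_imp_power_dvd) simp
    ultimately show ?thesis by (simp add: dvd_mult dvd_mult2)
  qed
  then have "q ^ Suc M dvd (\<Sum>m\<le>M. T m - (U (Suc m) - U m))" by (intro dvd_sum) simp
  also have "(\<Sum>m\<le>M. T m - (U (Suc m) - U m)) = (\<Sum>m\<le>M. T m) - (\<Sum>m\<le>M. U (Suc m) - U m)"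
    by (rule sum_subtractf)
  also have "(\<Sum>m\<le>M. U (Suc m) - U m) = U (Suc M) - U 0"
    using sum_lessThan_telescope[of U "Suc M"] by (simp add: lessThan_Suc_atMost)
  also have "U 0 = 0" unfolding U_def using A[of 0] by simp
  also have "U (Suc M) = 1" by (simp add: U_def B_def)
  also have "(\<Sum>m\<le>M. T m) = K i + b * q ^ Suc i * K (Suc i)"
    unfolding T_def K_def by (simp only: sum.distrib sum_distrib_left)
  finally show ?thesis by simp
qed

text \<open>Modulo \<open>q ^ Suc M\<close>, iterating
  \<open>K i = 1 - b * q ^ Suc i * K (Suc i)\<close> from \<open>i = 0\<close> accumulates the
  powers of \<open>q\<close> to triangular exponents. After \<open>Suc M\<close> rounds the
  remainder vanishes too.\<close>

lemma partial_theta: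
  fixes b q :: "'a::comm_ring_1"
  shows "q ^ Suc M dvd (\<Sum>m\<le>M. q ^ m * (\<Prod>j\<in>{m<..M}. 1 - q ^ j) * (\<Prod>j\<in>{m<..M}. 1 - b * q ^ j)) -
    (\<Sum>r\<le>M. (- b) ^ r * q ^ (r * (r + 1) div 2))"
proof -
  define K where "K i = (\<Sum>m\<le>M. q ^ m * (\<Prod>j\<in>{m<..M}. 1 - q ^ j) * (\<Prod>j\<in>{m + i<..M}. 1 - b * q ^ j))" for i
  define t where "t r = r * (r + 1) div 2" for r :: nat
  have tS: "t (Suc r) = t r + Suc r" for r
  proof -
    have "Suc r * (Suc r + 1) = r * (r + 1) + 2 * Suc r" by (simp add: algebra_simps)
    then show ?thesis unfolding t_def by (simp only:) simp
  qed
  have step: "q ^ Suc M dvd K i + b * q ^ Suc i * K (Suc i) - 1" for i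
    unfolding K_def by (rule telescoping_theta)
  have "q ^ Suc M dvd K 0 - ((\<Sum>r<R. (- b) ^ r * q ^ t r) + (- b) ^ R * q ^ t R * K R)" for R
  proof (induction R)
    case (Suc R)
    have "q ^ Suc M dvd (- b) ^ R * q ^ t R * (K R + b * q ^ Suc R * K (Suc R) - 1)"
      using step by (rule dvd_mult)
    from dvd_add[OF Suc this] show ?case
      by (simp add: tS power_add algebra_simps)
  qed (simp add: t_def)
  from this[of "Suc M"] have "q ^ Suc M dvd
      K 0 - ((\<Sum>r\<le>M. (- b) ^ r * q ^ t r) + (- b) ^ Suc M * q ^ t (Suc M) * K (Suc M))"
    by (simp only: lessThan_Suc_atMost)
  moreover have "q ^ Suc M dvd (- b) ^ Suc M * q ^ t (Suc M) * K (Suc M)"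
  proof -
    have "q ^ Suc M dvd q ^ t (Suc M)" by (intro le_imp_power_dvd) (simp add: tS)
    then show ?thesis by (intro dvd_mult2 dvd_mult)
  qed
  ultimately have "q ^ Suc M dvd K 0 - ((\<Sum>r\<le>M. (- b) ^ r * q ^ t r) + (- b) ^ Suc M * q ^ t (Suc M) * K (Suc M)) +
      (- b) ^ Suc M * q ^ t (Suc M) * K (Suc M)" by (rule dvd_add)
  then have "q ^ Suc M dvd K 0 - (\<Sum>r\<le>M. (- b) ^ r * q ^ t r)" by (simp only: diff_diff_eq[symmetric] diff_add_cancel)
  then show ?thesis by (simp add: K_def t_def)
qed

text \<open>Up to order \<open>n\<close> the generating function is 1 plus \<open>w * fps_X\<close>
  times a partial theta series, whose exponents are triangular; the hypothesis on \<open>n\<close>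
  avoids all of them.\<close>

lemma sum_D3_eq_0:
  fixes z :: "'a::comm_ring_1"
  assumes z: "1 + z + z\<^sup>2 = 0" and n: "\<forall>r::nat. n \<noteq> r * (r + 1) div 2 + 1" and "1 \<le> n"
  shows "(\<Sum>xs\<in>D3 n. z ^ tau xs) = 0"
proof -
  define w where "w = fps_const z"
  let ?q = "fps_X :: 'a fps"
  define P where "P m = (\<Prod>j\<in>{m<..n}. 1 + w * ?q ^ j + w\<^sup>2 * ?q ^ (2 * j))" for m
  have w: "1 + w + w\<^sup>2 = 0" using z unfolding w_def
    by (metis fps_const_1_eq_1 fps_const_0_eq_0 fps_const_add fps_const_power)
  have "w ^ 3 - 1 = (w - 1) * (1 + w + w\<^sup>2)" by (simp add: algebra_simps power2_eq_square power3_eq_cube)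
  then have w3: "w ^ 3 = 1" using w by simp
  \<comment> \<open>Splits each factor in the form required by \<open>partial_theta\<close>, with
    \<open>b\<close> the square of \<open>w\<close>.\<close>
  have "1 + w * x + w\<^sup>2 * x\<^sup>2 = (1 - x) * (1 - w\<^sup>2 * x) + (1 + w + w\<^sup>2) * x" for x
    by (simp add: algebra_simps power2_eq_square)
  then have factor: "1 + w * x + w\<^sup>2 * x\<^sup>2 = (1 - x) * (1 - w\<^sup>2 * x)" for x using w by simp
  have P: "P m = (\<Prod>j\<in>{m<..n}. 1 - ?q ^ j) * (\<Prod>j\<in>{m<..n}. 1 - w\<^sup>2 * ?q ^ j)" for m
    unfolding P_def prod.distrib[symmetric]
    by (intro prod.cong refl) (simp only: mult.commute[of 2] power_mult factor)
  obtain F where F: "(\<Sum>m\<le>n. ?q ^ m * P m) - (\<Sum>r\<le>n. (- w\<^sup>2) ^ r * ?q ^ (r * (r + 1) div 2)) = ?q ^ Suc n * F"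
    using partial_theta[of ?q n "w\<^sup>2"] unfolding P mult.assoc dvd_def by blast
  \<comment> \<open>As \<open>n\<close> is positive, the constant 1 drops out and the factor
    \<open>fps_X\<close> moves coefficient \<open>n\<close> to coefficient \<open>N\<close>, where
    neither \<open>?q ^ n * P n\<close> nor the error term is visible.\<close>
  obtain N where N: "n = Suc N" using \<open>1 \<le> n\<close> by (cases n) auto
  have "(\<Sum>xs\<in>D3 n. z ^ tau xs) = fps_nth (1 + w * (\<Sum>m<n. ?q ^ Suc m * P m)) n"
    unfolding sum_D3_eq_coeff w_def[symmetric] using sum_cube_power_prod[OF w3, of ?q n] by (simp add: P_def)
  also have "(\<Sum>m<n. ?q ^ Suc m * P m) = ?q * (\<Sum>m<n. ?q ^ m * P m)"
    by (simp add: sum_distrib_left mult.assoc)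
  also have "(\<Sum>m<n. ?q ^ m * P m) = (\<Sum>m\<le>n. ?q ^ m * P m) - ?q ^ n * P n"
    by (simp add: lessThan_Suc_atMost[symmetric])
  also have "(\<Sum>m\<le>n. ?q ^ m * P m) = (\<Sum>r\<le>n. (- w\<^sup>2) ^ r * ?q ^ (r * (r + 1) div 2)) + ?q ^ Suc n * F"
    using F by (simp add: algebra_simps)
  also have "fps_nth (1 + w * (?q * ((\<Sum>r\<le>n. (- w\<^sup>2) ^ r * ?q ^ (r * (r + 1) div 2)) + ?q ^ Suc n * F - ?q ^ n * P n))) n =
      z * fps_nth ((\<Sum>r\<le>n. (- w\<^sup>2) ^ r * ?q ^ (r * (r + 1) div 2)) + ?q ^ Suc n * F - ?q ^ n * P n) N"
    by (simp add: N w_def)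
  also have "fps_nth ((\<Sum>r\<le>n. (- w\<^sup>2) ^ r * ?q ^ (r * (r + 1) div 2)) + ?q ^ Suc n * F - ?q ^ n * P n) N =
      (\<Sum>r\<le>n. fps_nth ((- w\<^sup>2) ^ r * ?q ^ (r * (r + 1) div 2)) N)"
    by (simp add: fps_sum_nth fps_X_power_mult_nth N del: power_Suc)
  also have "\<dots> = 0"
  proof (rule sum.neutral, rule ballI)
    fix r
    have "(- w\<^sup>2) ^ r = fps_const ((- z\<^sup>2) ^ r)" by (simp add: w_def)
    moreover have "N \<noteq> r * (r + 1) div 2" using n N by auto
    ultimately show "fps_nth ((- w\<^sup>2) ^ r * ?q ^ (r * (r + 1) div 2)) N = 0"
      by (simp add: fps_X_power_nth)
  qed
  finally show ?thesis by simp
qed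

section \<open>Class sizes from a cube root of unity\<close>

lemma D3_eq_classes:
  shows "D3 n = (D3_class 0 n \<union> D3_class 1 n) \<union> D3_class 2 n"
    and "D3_class 0 n \<inter> D3_class 1 n = {}" "(D3_class 0 n \<union> D3_class 1 n) \<inter> D3_class 2 n = {}"
    and "finite (D3_class i n)"
proof -
  have "tau xs mod 3 = 0 \<or> tau xs mod 3 = 1 \<or> tau xs mod 3 = 2" for xs by linarith
  then show "D3 n = (D3_class 0 n \<union> D3_class 1 n) \<union> D3_class 2 n" by (auto simp: D3_class_def)
qed (use finite_D3 in \<open>auto simp: D3_class_def\<close>)

lemma card_D3: "card (D3 n) = card (D3_class 0 n) + card (D3_class 1 n) + card (D3_class 2 n)"
  by (subst D3_eq_classes(1)) (simp only: card_Un_disjoint D3_eq_classes(2-4) finite_UnI)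

text \<open>The vanishing combination of 1, \<open>z\<close> and its square has real coefficients:
  its imaginary part equates classes 1 and 2, and its real part then equates class 0 with
  them.\<close>

lemma card_D3_class_eq:
  assumes "\<forall>r::nat. n \<noteq> r * (r + 1) div 2 + 1" "1 \<le> n"
  shows "card (D3_class 0 n) = card (D3_class 1 n)" "card (D3_class 1 n) = card (D3_class 2 n)"
proof -
  define z where "z = Complex (- 1 / 2) (sqrt 3 / 2)"
  have z2: "z\<^sup>2 = Complex (- 1 / 2) (- sqrt 3 / 2)"
    by (simp add: z_def power2_eq_square complex_eq_iff)
  then have z: "1 + z + z\<^sup>2 = 0" by (simp add: z_def complex_eq_iff)
  have "z ^ 3 - 1 = (z - 1) * (1 + z + z\<^sup>2)" by (simp add: algebra_simps power2_eq_square power3_eq_cube)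
  then have z3: "z ^ 3 = 1" using z by simp
  have pow: "z ^ k = z ^ (k mod 3)" for k
  proof -
    have "z ^ k = z ^ (3 * (k div 3) + k mod 3)" by simp
    then show ?thesis unfolding power_add power_mult z3 by simp
  qed
  have cls: "(\<Sum>xs\<in>D3_class i n. z ^ tau xs) = of_nat (card (D3_class i n)) * z ^ i" if "i < 3" for i
  proof -
    have "(\<Sum>xs\<in>D3_class i n. z ^ tau xs) = (\<Sum>xs\<in>D3_class i n. z ^ i)"
    proof (rule sum.cong[OF refl])
      fix xs assume "xs \<in> D3_class i n"
      then have "tau xs mod 3 = i" using that by (simp add: D3_class_def)
      then show "z ^ tau xs = z ^ i" using pow[of "tau xs"] by simp
    qed
    then show ?thesis by simp
  qed
  have "0 = (\<Sum>xs\<in>D3 n. z ^ tau xs)" using sum_D3_eq_0[OF z assms] by simp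
  also have "\<dots> = of_nat (card (D3_class 0 n)) * z ^ 0 + of_nat (card (D3_class 1 n)) * z ^ 1 +
      of_nat (card (D3_class 2 n)) * z ^ 2"
  proof -
    have "(0::nat) < 3" "(1::nat) < 3" "(2::nat) < 3" by simp_all
    then show ?thesis
      by (subst D3_eq_classes(1)) (simp only: sum.union_disjoint D3_eq_classes(2-4) finite_UnI cls)
  qed
  finally have eq: "of_nat (card (D3_class 0 n)) + of_nat (card (D3_class 1 n)) * z +
      of_nat (card (D3_class 2 n)) * z\<^sup>2 = 0" by simp
  have "real (card (D3_class 1 n)) * sqrt 3 = real (card (D3_class 2 n)) * sqrt 3"
    using arg_cong[OF eq, of Im] unfolding z2 by (simp add: z_def)
  then have 12: "real (card (D3_class 1 n)) = real (card (D3_class 2 n))" by simp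
  then show "card (D3_class 1 n) = card (D3_class 2 n)" by simp
  have "real (card (D3_class 0 n)) = real (card (D3_class 1 n))"
    using arg_cong[OF eq, of Re] 12 unfolding z2 by (simp add: z_def)
  then show "card (D3_class 0 n) = card (D3_class 1 n)" by simp
qed

theorem theorem1p2:
  fixes n :: nat
  assumes "n \<ge> 1"
  shows "bij_betw iota (C3 n) (D3_class 0 n) \<and>
    ((\<forall>r::nat. n \<noteq> r * (r + 1) div 2 + 1) \<longrightarrow>
      card (C3 n) = card (D3_class 0 n) \<and>
      card (D3_class 0 n) = card (D3_class 1 n) \<and>
      card (D3_class 1 n) = card (D3_class 2 n) \<and>
      real (card (D3_class 2 n)) = real (card (D3 n)) / 3)"
proof (intro conjI impI)
  \<comment> \<open>\<open>Gamma3\<close> lowers the weight by 1 and \<open>T_map\<close> raises it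
    again, hence the shift.\<close>
  obtain N where N: "n = Suc N" using assms by (cases n) auto
  have "iota = T_map \<circ> (conjugate \<circ> (Phi3_inv \<circ> Gamma3))"
    by (simp add: fun_eq_iff iota_def)
  then show bij: "bij_betw iota (C3 n) (D3_class 0 n)"
    unfolding N
    using bij_betw_trans[OF bij_betw_trans[OF bij_betw_trans[OF bij_betw_Gamma3 bij_betw_Phi3_inv]
        bij_betw_conjugate] bij_betw_T_map] by simp
  then show "card (C3 n) = card (D3_class 0 n)" by (rule bij_betw_same_card)
  assume "\<forall>r::nat. n \<noteq> r * (r + 1) div 2 + 1"
  note eq = card_D3_class_eq[OF this assms]
  then show "card (D3_class 0 n) = card (D3_class 1 n)" "card (D3_class 1 n) = card (D3_class 2 n)"
    by auto
  show "real (card (D3_class 2 n)) = real (card (D3 n)) / 3"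
    using eq card_D3[of n] by simp
qed

end
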